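(* Let $A$ and $B$ be symmetric $n\times n$ real matrices, with $B=\begin{pmatrix}0&0\\0&D\end{pmatrix}$ where $D$ is a positive definite symmetric $n_2\times n_2$ matrix, and assume that the pair $(A,B)$ satisfies the Kalman rank condition, i.e. the matrix $(B,AB,\ldots,A^{n-1}B)$ has full rank $n$. Let $U_0\in H^1(\mathbb{R};\mathbb{R}^n)$, and let $U=(U_1,U_2)$ be the solution of $$\partial_t U+A\partial_x U=-BU,\quad (x,t)\in\mathbb{R}\times\mathbb{R}_+,\qquad U(x,0)=U_0(x).$$ Then, for all $t>0$, $$\|U_2(t)\|_{L^2}+\|\partial_xU(t)\|_{L^2}\le C(1+t)^{-\frac12}\|U_0\|_{H^1},$$ where $C>0$ is a constant independent of time and of $U_0$.
   Context: Here $n\ge2$, $1\le n_2<n$ and $n_1=n-n_2$. The unknown $U=U(x,t)\in\mathbb{R}^n$ is written $U=(U_1,U_2)$ with $U_1\in\mathbb{R}^{n_1}=\mathrm{Ker}(B)$ and $U_2\in\mathbb{R}^{n_2}=\mathrm{Im}(B)$. All norms are taken over $x\in\mathbb{R}$. *)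

theory Defs
  imports "HOL-Analysis.Analysis"
begin

section \<open>Matrices\<close>

text \<open>
  The decomposition \<open>n = n\<^sub>1 + n\<^sub>2\<close> with \<open>n\<^sub>1, n\<^sub>2 \<ge> 1\<close> is carried by the index type
  \<open>'p + 'q\<close> with \<open>CARD('p) = n\<^sub>1\<close> and \<open>CARD('q) = n\<^sub>2\<close>: the coordinates \<open>Inl _\<close> of a vector
  of \<open>real ^ ('p + 'q)\<close> form its first block and the coordinates \<open>Inr _\<close> its second one.
\<close>

definition snd_block :: "real ^ ('p::finite + 'q::finite) \<Rightarrow> real ^ 'q" where
  "snd_block u = (\<chi> j. u $ Inr j)"

definition block_diag_zero :: "real ^ 'q ^ 'q \<Rightarrow> real ^ ('p::finite + 'q::finite) ^ ('p + 'q)" where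
  "block_diag_zero D =
     (\<chi> i j. case (i, j) of (Inr k, Inr l) \<Rightarrow> D $ k $ l | _ \<Rightarrow> 0)"

definition pos_def_matrix :: "real ^ 'n ^ 'n \<Rightarrow> bool" where
  "pos_def_matrix D \<longleftrightarrow> transpose D = D \<and> (\<forall>x. x \<noteq> 0 \<longrightarrow> x \<bullet> (D *v x) > 0)"

text \<open>
  The \<open>n \<times> n\<^sup>2\<close> matrix \<open>(B, AB, \<dots>, A\<^bsup>n-1\<^esup>B)\<close>.  Its columns are indexed by pairs in
  \<open>'n \<times> 'n\<close>: the bijection \<open>to_nat_on UNIV\<close> from \<open>'n\<close> to \<open>{..<CARD('n)}\<close> turns the first
  component into the exponent of \<open>A\<close>, and the second component is the column within the block.
  Note that \<open>^\<close> on \<open>real ^ 'n ^ 'n\<close> is the componentwise power, hence the iteration of \<open>**\<close>.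
\<close>

definition kalman_matrix :: "real ^ 'n ^ 'n \<Rightarrow> real ^ 'n ^ 'n \<Rightarrow> real ^ ('n \<times> 'n) ^ 'n" where
  "kalman_matrix A B =
     (\<chi> i p. ((((**) A) ^^ to_nat_on UNIV (fst p)) B) $ i $ snd p)"

definition kalman_rank_condition :: "real ^ 'n ^ 'n \<Rightarrow> real ^ 'n ^ 'n \<Rightarrow> bool" where
  "kalman_rank_condition A B \<longleftrightarrow> rank (kalman_matrix A B) = CARD('n)"

lemma columns_kalman_matrix:
  fixes A B :: "real ^ 'n ^ 'n"
  shows "columns (kalman_matrix A B) = (\<Union>k<CARD('n). columns ((((**) A) ^^ k) B))"
proof -
  have r: "{..<CARD('n)} = range (to_nat_on (UNIV :: 'n set))"
    using to_nat_on_finite[of "UNIV :: 'n set"] by (simp add: bij_betw_def)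
  have c: "column (a, j) (kalman_matrix A B)
      = column j ((((**) A) ^^ to_nat_on UNIV a) B)" for a j
    by (simp add: column_def kalman_matrix_def)
  show ?thesis
    unfolding r columns_def by (auto simp: c)
qed

section \<open>Function spaces on the real line\<close>

text \<open>
  Elements of \<open>L\<^sup>2\<close> and \<open>H\<^sup>1\<close> are represented by functions; all notions below are invariant
  under modification on Lebesgue null sets (within Borel functions).
\<close>

definition L2 :: "(real \<Rightarrow> 'e::euclidean_space) set" where
  "L2 = {u. u \<in> borel_measurable borel \<and> integrable lborel (\<lambda>x. (norm (u x))\<^sup>2)}"

definition L2_norm :: "(real \<Rightarrow> 'e::euclidean_space) \<Rightarrow> real" where
  "L2_norm u = sqrt (LINT x|lborel. (norm (u x))\<^sup>2)"

definition test_function :: "(real \<Rightarrow> real) \<Rightarrow> bool" where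
  "test_function \<phi> \<longleftrightarrow>
     (\<forall>k x. (deriv ^^ k) \<phi> differentiable at x) \<and> compact (closure {x. \<phi> x \<noteq> 0})"

definition has_weak_deriv ::
    "(real \<Rightarrow> 'e::euclidean_space) \<Rightarrow> (real \<Rightarrow> 'e) \<Rightarrow> bool" where
  "has_weak_deriv u v \<longleftrightarrow>
     (\<forall>\<phi>. test_function \<phi> \<longrightarrow>
        (LINT x|lborel. deriv \<phi> x *\<^sub>R u x) = - (LINT x|lborel. \<phi> x *\<^sub>R v x))"

definition H1 :: "(real \<Rightarrow> 'e::euclidean_space) set" where
  "H1 = {u \<in> L2. \<exists>v \<in> L2. has_weak_deriv u v}"

text \<open>Weak derivatives are unique up to null sets, so the choice is immaterial for \<open>u \<in> H1\<close>.\<close>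

definition weak_deriv :: "(real \<Rightarrow> 'e::euclidean_space) \<Rightarrow> real \<Rightarrow> 'e" where
  "weak_deriv u = (SOME v. v \<in> L2 \<and> has_weak_deriv u v)"

definition H1_norm :: "(real \<Rightarrow> 'e::euclidean_space) \<Rightarrow> real" where
  "H1_norm u = sqrt ((L2_norm u)\<^sup>2 + (L2_norm (weak_deriv u))\<^sup>2)"

section \<open>Solutions of the hyperbolic system\<close>

text \<open>
  \<open>U t\<close> is the function \<open>x \<mapsto> U(x,t)\<close>.  A solution with initial datum \<open>U\<^sub>0 \<in> H\<^sup>1\<close> is taken in the
  class \<open>C([0,\<infinity>); H\<^sup>1) \<inter> C\<^sup>1([0,\<infinity>); L\<^sup>2)\<close>, in which the Cauchy problem is well-posed for
  symmetric \<open>A\<close>.  The function \<open>V\<close> is the time derivative of \<open>U\<close>, in the sense of limits of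
  difference quotients in \<open>L\<^sup>2\<close> (one-sided at \<open>t = 0\<close>).
\<close>

definition solves_system ::
    "real ^ 'n ^ 'n \<Rightarrow> real ^ 'n ^ 'n \<Rightarrow> (real \<Rightarrow> real ^ 'n) \<Rightarrow> (real \<Rightarrow> real \<Rightarrow> real ^ 'n) \<Rightarrow> bool" where
  "solves_system A B U0 U \<longleftrightarrow>
     (\<forall>t\<ge>0. U t \<in> H1) \<and>
     (\<forall>t\<ge>0. ((\<lambda>s. H1_norm (\<lambda>x. U s x - U t x)) \<longlongrightarrow> 0) (at t within {0..})) \<and>
     (\<exists>V. (\<forall>t\<ge>0. V t \<in> L2) \<and>
        (\<forall>t\<ge>0. ((\<lambda>s. L2_norm (\<lambda>x. V s x - V t x)) \<longlongrightarrow> 0) (at t within {0..})) \<and>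
        (\<forall>t\<ge>0. ((\<lambda>s. L2_norm (\<lambda>x. (1 / (s - t)) *\<^sub>R (U s x - U t x) - V t x)) \<longlongrightarrow> 0)
                  (at t within {0..})) \<and>
        (\<forall>t\<ge>0. AE x in lborel. V t x + A *v weak_deriv (U t) x = - (B *v U t x))) \<and>
     (AE x in lborel. U 0 x = U0 x)"

end

theory Submission
  imports Defs
begin

text \<open>
  The estimate is hypocoercive, in physical space.  Modulo null sets, \<open>L\<^sup>2\<close> is an inner product space on
  which translations act isometrically, and an \<open>H\<^sup>1\<close> function with its weak derivative is a pair in the
  generator of the translation group.  Writing \<open>P = \<partial>\<^sub>x U\<close>, symmetry of \<open>A\<close> makes \<open>\<parallel>U\<parallel>\<^sup>2\<close> and \<open>\<parallel>P\<parallel>\<^sup>2\<close>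
  dissipate only \<open>\<langle>U, B U\<rangle>\<close> and \<open>\<langle>P, B P\<rangle>\<close>; the identity for \<open>P\<close> comes from that for the difference
  quotients in \<open>x\<close>, which are solutions too.  The corrector \<open>J = \<Sum> w\<^sub>k \<langle>B A\<^sup>k U, B A\<^bsup>k+1\<^esup> P\<rangle>\<close> recovers the
  missing dissipation: with suitable weights \<open>J' \<le> - \<delta> \<parallel>P\<parallel>\<^sup>2 + K (\<parallel>B P\<parallel>\<^sup>2 + \<parallel>B U\<parallel>\<^sup>2)\<close>, because the Kalman
  condition says that \<open>\<Sum> |B A\<^sup>k x|\<^sup>2\<close> is positive definite.  Hence
  \<open>\<Lambda> (\<parallel>U\<parallel>\<^sup>2 + \<parallel>P\<parallel>\<^sup>2) + J + \<delta> t \<parallel>P\<parallel>\<^sup>2\<close> is nonincreasing for large \<open>\<Lambda>\<close>, which gives the decay of \<open>P\<close>.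
  Finally \<open>\<langle>U, B U\<rangle>\<close> is exponentially damped with source \<open>\<parallel>P\<parallel>\<^sup>2\<close>, so it inherits the rate of \<open>\<parallel>P\<parallel>\<^sup>2\<close>.
\<close>

section \<open>The Hilbert space of square integrable functions\<close>

text \<open>The obstacle is regularity. The solution class gives \<open>U\<close> a time derivative
  only in L2, so \<open>P\<close> is merely continuous in time, and neither its energy nor the
  corrector can be differentiated directly. For the energy the remedy is a time-integrated identity
  obtained by dominated convergence; for the corrector it is the pairing of \<open>P\<close> with
  \<open>U\<close>, because the space derivative is skew-adjoint. A second gap is that
  \<open>H1\<close> is defined by weak derivatives, while the argument needs norm limits of
  difference quotients. Closing it uses strong continuity of translations, hence density of test
  functions, hence explicit smooth cutoffs. The rate reflects that J' controls |P|^2 but not |U|^2.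
  So no exponential weight is available; |P|^2 carries the weight t instead, whose derivative is
  exactly what J' pays for, while the weighted dissipation -2 \<delta> t \<langle>P, B P\<rangle>
  has a good sign. The coercivity bounds for \<open>B\<close> and for the Kalman rows are proved in
  finite dimension and integrated over x.\<close>

lemma integrable_lborel_bound:
  fixes f :: "real \<Rightarrow> real" and g :: "real \<Rightarrow> 'a::euclidean_space"
  assumes "integrable lborel f" and "\<And>x. norm (g x) \<le> f x" and "g \<in> borel_measurable borel"
  shows "integrable lborel g"
  by (rule Bochner_Integration.integrable_bound[OF assms(1)])
     (use assms in \<open>auto intro: order_trans[OF _ abs_ge_self]\<close>)

lemma L2_zero: "(\<lambda>x. 0) \<in> L2"
  by (simp add: L2_def)

lemma L2_add:
  assumes "f \<in> L2" "g \<in> L2"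
  shows "(\<lambda>x. f x + g x) \<in> L2"
proof -
  have [measurable]: "f \<in> borel_measurable borel" "g \<in> borel_measurable borel"
    using assms by (auto simp: L2_def)
  have "integrable lborel (\<lambda>x. 2 * (norm (f x))\<^sup>2 + 2 * (norm (g x))\<^sup>2)"
    using assms by (auto simp: L2_def)
  moreover have "(norm (f x + g x))\<^sup>2 \<le> 2 * (norm (f x))\<^sup>2 + 2 * (norm (g x))\<^sup>2" for x
  proof -
    have "(norm (f x + g x))\<^sup>2 \<le> (norm (f x) + norm (g x))\<^sup>2"
      by (intro power_mono norm_triangle_ineq) auto
    also have "\<dots> \<le> 2 * (norm (f x))\<^sup>2 + 2 * (norm (g x))\<^sup>2"
      using sum_squares_bound[of "norm (f x)" "norm (g x)"] by (simp add: power2_sum)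
    finally show ?thesis .
  qed
  ultimately have "integrable lborel (\<lambda>x. (norm (f x + g x))\<^sup>2)"
    by - (erule integrable_lborel_bound, auto)
  then show ?thesis by (simp add: L2_def)
qed

lemma L2_bounded_linear:
  fixes F :: "'a::euclidean_space \<Rightarrow> 'b::euclidean_space"
  assumes F: "bounded_linear F" and f: "f \<in> L2"
  shows "(\<lambda>x. F (f x)) \<in> L2"
proof -
  have [measurable]: "f \<in> borel_measurable borel"
    using assms by (auto simp: L2_def)
  have [measurable]: "F \<in> borel_measurable borel"
    using F by (intro borel_measurable_continuous_onI linear_continuous_on)
  obtain K where K: "\<And>x. norm (F x) \<le> norm x * K"
    using F bounded_linear.bounded by blast
  have "integrable lborel (\<lambda>x. K\<^sup>2 * (norm (f x))\<^sup>2)"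
    using f by (auto simp: L2_def)
  moreover have "(norm (F (f x)))\<^sup>2 \<le> K\<^sup>2 * (norm (f x))\<^sup>2" for x
    using power_mono[OF K[of "f x"] norm_ge_zero, of 2] by (simp add: power_mult_distrib mult.commute)
  ultimately have "integrable lborel (\<lambda>x. (norm (F (f x)))\<^sup>2)"
    by - (erule integrable_lborel_bound, auto)
  then show ?thesis by (simp add: L2_def)
qed

lemma L2_scaleR: "f \<in> L2 \<Longrightarrow> (\<lambda>x. c *\<^sub>R f x) \<in> L2"
  by (rule L2_bounded_linear[OF bounded_linear_scaleR_right])

lemma L2_minus: "f \<in> L2 \<Longrightarrow> (\<lambda>x. - f x) \<in> L2"
  using L2_scaleR[of f "-1"] by simp

lemma L2_diff: "f \<in> L2 \<Longrightarrow> g \<in> L2 \<Longrightarrow> (\<lambda>x. f x - g x) \<in> L2"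
  using L2_add[of f "\<lambda>x. - g x"] L2_minus[of g] by simp

lemma L2_integrable_inner:
  assumes "f \<in> L2" "g \<in> L2"
  shows "integrable lborel (\<lambda>x. f x \<bullet> g x)"
proof -
  have [measurable]: "f \<in> borel_measurable borel" "g \<in> borel_measurable borel"
    using assms by (auto simp: L2_def)
  have "integrable lborel (\<lambda>x. (norm (f x))\<^sup>2 + (norm (g x))\<^sup>2)"
    using assms by (auto simp: L2_def)
  moreover have "norm (f x \<bullet> g x) \<le> (norm (f x))\<^sup>2 + (norm (g x))\<^sup>2" for x
  proof -
    have "\<bar>f x \<bullet> g x\<bar> \<le> norm (f x) * norm (g x)" by (rule Cauchy_Schwarz_ineq2)
    also have "\<dots> \<le> 2 * norm (f x) * norm (g x)" by simp
    also have "\<dots> \<le> (norm (f x))\<^sup>2 + (norm (g x))\<^sup>2" by (rule sum_squares_bound)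
    finally show ?thesis by simp
  qed
  ultimately show ?thesis
    by - (erule integrable_lborel_bound, auto)
qed

lemma AE_lborel_translate:
  assumes "AE x in lborel. P x"
  shows "AE x in lborel. P (x + h :: real)"
proof -
  have "AE x in distr lborel borel ((+) h). P x"
    using assms by (subst lborel_distr_plus)
  then have "AE x in lborel. P (h + x)"
    by (rule AE_distrD[rotated]) simp
  then show ?thesis by (simp add: add.commute)
qed

lemma integral_translate:
  fixes f :: "real \<Rightarrow> real"
  shows "(LINT x|lborel. f (x + h)) = (LINT x|lborel. f x)"
  using lborel_integral_real_affine[of 1 f h] by (simp add: add.commute)

lemma integrable_translate:
  fixes f :: "real \<Rightarrow> real"
  shows "integrable lborel f \<Longrightarrow> integrable lborel (\<lambda>x. f (x + h))"
  using lborel_integrable_real_affine[of f 1 h] by (simp add: add.commute)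

lemma L2_translate: "f \<in> L2 \<Longrightarrow> (\<lambda>x. f (x + h)) \<in> L2"
  using integrable_translate[of "\<lambda>x. (norm (f x))\<^sup>2" h] by (auto simp: L2_def)

section \<open>L2 on the line as a real inner product space of classes\<close>

definition l2rel :: "(real \<Rightarrow> 'e::euclidean_space) \<Rightarrow> (real \<Rightarrow> 'e) \<Rightarrow> bool" where
  "l2rel f g \<longleftrightarrow> f \<in> L2 \<and> g \<in> L2 \<and> (AE x in lborel. f x = g x)"

\<comment> \<open>The relation is reflexive exactly on \<open>L2\<close>, hence a partial quotient.
  In the space of classes norm zero means zero, so limits are unique and the calculus of
  vector-valued derivatives applies to curves of functions.\<close>
quotient_type (overloaded) 'e l2 = "real \<Rightarrow> 'e::euclidean_space" / partial: l2rel
proof (rule part_equivpI)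
  show "\<exists>x::real \<Rightarrow> 'e. l2rel x x"
    by (rule exI[of _ "\<lambda>_. 0"]) (auto simp: l2rel_def L2_zero)
  show "symp (l2rel :: (real \<Rightarrow> 'e) \<Rightarrow> _)"
    by (auto simp: symp_def l2rel_def elim: eventually_mono)
  show "transp (l2rel :: (real \<Rightarrow> 'e) \<Rightarrow> _)"
  proof (rule transpI)
    fix f g h :: "real \<Rightarrow> 'e" assume "l2rel f g" "l2rel g h"
    then show "l2rel f h"
      unfolding l2rel_def by (auto elim: eventually_elim2)
  qed
qed

instantiation l2 :: (euclidean_space) real_inner
begin

lift_definition zero_l2 :: "'a l2" is "\<lambda>_. 0"
  by (simp add: l2rel_def L2_zero)

lift_definition plus_l2 :: "'a l2 \<Rightarrow> 'a l2 \<Rightarrow> 'a l2" is "\<lambda>f g x. f x + g x"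
  by (auto simp: l2rel_def L2_add elim: eventually_elim2)

lift_definition minus_l2 :: "'a l2 \<Rightarrow> 'a l2 \<Rightarrow> 'a l2" is "\<lambda>f g x. f x - g x"
  by (auto simp: l2rel_def L2_diff elim: eventually_elim2)

lift_definition uminus_l2 :: "'a l2 \<Rightarrow> 'a l2" is "\<lambda>f x. - f x"
  by (auto simp: l2rel_def L2_minus)

lift_definition scaleR_l2 :: "real \<Rightarrow> 'a l2 \<Rightarrow> 'a l2" is "\<lambda>c f x. c *\<^sub>R f x"
  by (auto simp: l2rel_def L2_scaleR elim: eventually_mono)

lift_definition inner_l2 :: "'a l2 \<Rightarrow> 'a l2 \<Rightarrow> real" is "\<lambda>f g. LINT x|lborel. f x \<bullet> g x"
proof -
  fix f f' g g' :: "real \<Rightarrow> 'a" assume *: "l2rel f f'" "l2rel g g'"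
  have [measurable]: "f \<in> borel_measurable borel" "g \<in> borel_measurable borel"
    "f' \<in> borel_measurable borel" "g' \<in> borel_measurable borel"
    using * by (auto simp: l2rel_def L2_def)
  show "(LINT x|lborel. f x \<bullet> g x) = (LINT x|lborel. f' x \<bullet> g' x)"
    using * by (intro integral_cong_AE) (auto simp: l2rel_def elim: eventually_elim2)
qed

definition norm_l2 :: "'a l2 \<Rightarrow> real" where "norm_l2 u = sqrt (inner u u)"
definition dist_l2 :: "'a l2 \<Rightarrow> 'a l2 \<Rightarrow> real" where "dist_l2 u v = norm (u - v)"
definition sgn_l2 :: "'a l2 \<Rightarrow> 'a l2" where "sgn_l2 u = inverse (norm u) *\<^sub>R u"
definition uniformity_l2 :: "('a l2 \<times> 'a l2) filter"
  where "uniformity_l2 = (INF e\<in>{0 <..}. principal {(x, y). dist x y < e})"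
definition open_l2 :: "'a l2 set \<Rightarrow> bool"
  where "open_l2 S = (\<forall>x\<in>S. \<forall>\<^sub>F (x', y) in uniformity. x' = x \<longrightarrow> y \<in> S)"

instance
proof
  fix u v w :: "'a l2" and a b :: real
  show "u + v + w = u + (v + w)" by transfer (auto simp: l2rel_def add.assoc intro!: L2_add)
  show "u + v = v + u" by transfer (auto simp: l2rel_def add.commute intro!: L2_add)
  show "0 + u = u" by transfer (auto simp: l2rel_def)
  show "- u + u = 0" by transfer (auto simp: l2rel_def L2_zero)
  show "u - v = u + - v" by transfer (auto simp: l2rel_def intro!: L2_diff)
  show "a *\<^sub>R (u + v) = a *\<^sub>R u + a *\<^sub>R v"
    by transfer (auto simp: l2rel_def scaleR_add_right intro!: L2_add L2_scaleR)
  show "(a + b) *\<^sub>R u = a *\<^sub>R u + b *\<^sub>R u"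
    by transfer (auto simp: l2rel_def scaleR_add_left intro!: L2_add L2_scaleR)
  show "a *\<^sub>R b *\<^sub>R u = (a * b) *\<^sub>R u" by transfer (auto simp: l2rel_def intro!: L2_scaleR)
  show "1 *\<^sub>R u = u" by transfer (auto simp: l2rel_def)
  show "dist u v = norm (u - v)" by (rule dist_l2_def)
  show "sgn u = inverse (norm u) *\<^sub>R u" by (rule sgn_l2_def)
  show "(uniformity :: ('a l2 \<times> 'a l2) filter) = (INF e\<in>{0 <..}. principal {(x, y). dist x y < e})"
    by (rule uniformity_l2_def)
  show "open S = (\<forall>x\<in>S. \<forall>\<^sub>F (x', y) in uniformity. x' = x \<longrightarrow> y \<in> S)" for S :: "'a l2 set"
    by (rule open_l2_def)
  show "inner u v = inner v u" by transfer (simp add: inner_commute)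
  show "inner (u + v) w = inner u w + inner v w"
    by transfer (auto simp: l2rel_def inner_add_left L2_integrable_inner)
  show "inner (a *\<^sub>R u) v = a * inner u v"
    by transfer simp
  show "0 \<le> inner u u" by transfer simp
  show "(inner u u = 0) = (u = 0)"
    by transfer (auto simp: l2rel_def L2_zero L2_integrable_inner integral_nonneg_eq_0_iff_AE)
  show "norm u = sqrt (inner u u)" by (rule norm_l2_def)
qed

end

lemma norm_abs_l2: "f \<in> L2 \<Longrightarrow> norm (abs_l2 f) = L2_norm f"
  by (simp add: norm_l2_def inner_l2.abs_eq l2rel_def L2_norm_def power2_norm_eq_inner)

lemma abs_l2_eq_iff: "f \<in> L2 \<Longrightarrow> g \<in> L2 \<Longrightarrow> abs_l2 f = abs_l2 g \<longleftrightarrow> (AE x in lborel. f x = g x)"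
  using Quotient3_rel[OF Quotient3_l2, of f g] by (simp add: l2rel_def)

lemma l2_cases:
  obtains f where "f \<in> L2" "u = abs_l2 f"
  using Quotient3_abs_rep[OF Quotient3_l2, of u] Quotient3_rep_reflp[OF Quotient3_l2, of u]
  by (simp add: l2rel_def)

lemma abs_l2_diff: "f \<in> L2 \<Longrightarrow> g \<in> L2 \<Longrightarrow> abs_l2 f - abs_l2 g = abs_l2 (\<lambda>x. f x - g x)"
  by (simp add: minus_l2.abs_eq l2rel_def)

lemma abs_l2_scaleR: "f \<in> L2 \<Longrightarrow> c *\<^sub>R abs_l2 f = abs_l2 (\<lambda>x. c *\<^sub>R f x)"
  by (simp add: scaleR_l2.abs_eq l2rel_def)

lemma abs_l2_add: "f \<in> L2 \<Longrightarrow> g \<in> L2 \<Longrightarrow> abs_l2 f + abs_l2 g = abs_l2 (\<lambda>x. f x + g x)"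
  by (simp add: plus_l2.abs_eq l2rel_def)

lemma abs_l2_inner: "f \<in> L2 \<Longrightarrow> g \<in> L2 \<Longrightarrow> abs_l2 f \<bullet> abs_l2 g = (LINT x|lborel. f x \<bullet> g x)"
  by (simp add: inner_l2.abs_eq l2rel_def)

subsection \<open>Translations\<close>

lift_definition shift :: "real \<Rightarrow> 'e::euclidean_space l2 \<Rightarrow> 'e l2" is "\<lambda>h f x. f (x + h)"
proof -
  fix h and f g :: "real \<Rightarrow> 'e" assume "l2rel f g"
  then show "l2rel (\<lambda>x. f (x + h)) (\<lambda>x. g (x + h))"
    using AE_lborel_translate[of "\<lambda>x. f x = g x" h] by (simp add: l2rel_def L2_translate[of f] L2_translate[of g])
qed

lemma shift_abs: "f \<in> L2 \<Longrightarrow> shift h (abs_l2 f) = abs_l2 (\<lambda>x. f (x + h))"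
  by (simp add: shift.abs_eq l2rel_def)

lemma linear_shift: "linear (shift h)"
proof
  show "shift h (u + v) = shift h u + shift h v" for u v :: "'a l2"
  proof transfer
    fix h and f g :: "real \<Rightarrow> 'a" assume "l2rel f f" "l2rel g g"
    then show "l2rel (\<lambda>x. f (x + h) + g (x + h)) (\<lambda>x. f (x + h) + g (x + h))"
      by (simp add: l2rel_def L2_add L2_translate[of f] L2_translate[of g])
  qed
  show "shift h (c *\<^sub>R u) = c *\<^sub>R shift h u" for u :: "'a l2" and c
  proof transfer
    fix h c and f :: "real \<Rightarrow> 'a" assume "l2rel f f"
    then show "l2rel (\<lambda>x. c *\<^sub>R f (x + h)) (\<lambda>x. c *\<^sub>R f (x + h))"
      by (simp add: l2rel_def L2_scaleR L2_translate[of f])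
  qed
qed

lemma shift_shift: "shift h (shift k u) = shift (h + k) u"
proof transfer
  fix h k and f :: "real \<Rightarrow> 'a" assume "l2rel f f"
  then show "l2rel (\<lambda>x. f (x + h + k)) (\<lambda>x. f (x + (h + k)))"
    using L2_translate[of f "h + k"] by (simp add: l2rel_def add.assoc)
qed

lemma shift_0 [simp]: "shift 0 u = u"
  by transfer (auto simp: l2rel_def)

lemma inner_shift [simp]: "shift h u \<bullet> shift h v = u \<bullet> v"
proof transfer
  fix h and f g :: "real \<Rightarrow> 'a"
  show "(LINT x|lborel. f (x + h) \<bullet> g (x + h)) = (LINT x|lborel. f x \<bullet> g x)"
    using integral_translate[of "\<lambda>x. f x \<bullet> g x" h] .
qed

text \<open>Translations are unitary, so the adjoint of a shift is its inverse.\<close>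

lemma inner_shift_left: "shift h u \<bullet> v = u \<bullet> shift (- h) v"
  using inner_shift[of h u "shift (- h) v"] by (simp add: shift_shift)

lemma norm_shift [simp]: "norm (shift h u) = norm u"
  by (simp add: norm_eq_sqrt_inner)

lemma bounded_linear_shift: "bounded_linear (shift h)"
  by (rule bounded_linear_intro[where K = 1])
     (auto simp: linear_add[OF linear_shift] linear_scale[OF linear_shift])

subsection \<open>Constant matrices acting on vector fields\<close>

lemma L2_mat:
  fixes M :: "real ^ 'n ^ 'm"
  shows "f \<in> L2 \<Longrightarrow> (\<lambda>x. M *v f x) \<in> L2"
  by (rule L2_bounded_linear[OF matrix_vector_mul_bounded_linear])

lift_definition mat_l2 :: "real ^ 'n ^ 'm \<Rightarrow> (real ^ 'n) l2 \<Rightarrow> (real ^ 'm) l2" is "\<lambda>M f x. M *v f x"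
  by (auto simp: l2rel_def L2_mat elim: eventually_mono)

lemma mat_l2_abs: "f \<in> L2 \<Longrightarrow> mat_l2 M (abs_l2 f) = abs_l2 (\<lambda>x. M *v f x)"
  by (simp add: mat_l2.abs_eq l2rel_def)

lemma mat_l2_mult: "mat_l2 M (mat_l2 N u) = mat_l2 (M ** N) u"
  by transfer (auto simp: l2rel_def matrix_vector_mul_assoc intro!: L2_mat)

lemma shift_mat_l2: "shift h (mat_l2 M u) = mat_l2 M (shift h u)"
proof -
  obtain f where "f \<in> L2" "u = abs_l2 f" by (rule l2_cases)
  then show ?thesis
    by (simp add: mat_l2_abs shift_abs L2_mat L2_translate[of f] L2_translate[of "\<lambda>x. M *v f x"])
qed

lemma inner_mat_l2: "mat_l2 M u \<bullet> v = u \<bullet> mat_l2 (transpose M) v"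
proof -
  have "(M *v x) \<bullet> y = x \<bullet> (transpose M *v y)" for x y
    by (metis dot_lmul_matrix inner_commute transpose_matrix_vector)
  then show ?thesis by transfer simp
qed

lemma linear_mat_l2: "linear (mat_l2 M)"
proof
  show "mat_l2 M (u + v) = mat_l2 M u + mat_l2 M v" for u v
    by transfer (auto simp: l2rel_def matrix_vector_right_distrib intro!: L2_add L2_mat)
  show "mat_l2 M (c *\<^sub>R u) = c *\<^sub>R mat_l2 M u" for u and c
    by transfer (auto simp: l2rel_def matrix_vector_mult_scaleR intro!: L2_scaleR L2_mat)
qed

lemma mat_l2_one [simp]: "mat_l2 (mat 1) u = u"
  by transfer (simp add: l2rel_def)

text \<open>A pointwise inequality between quadratic forms survives integration over x. This is the
  bridge from matrix inequalities to L2; a single form is written as a sum over \<open>{()}\<close>,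
  with \<open>mat 1\<close> for the identity.\<close>

lemma quadratic_form_mono_l2:
  fixes M N :: "'i \<Rightarrow> real ^ 'n ^ 'k" and M' N' :: "'j \<Rightarrow> real ^ 'n ^ 'l"
  assumes "finite I" "finite J"
    and le: "\<And>x. c * (\<Sum>i\<in>I. (M i *v x) \<bullet> (N i *v x)) \<le> (\<Sum>j\<in>J. (M' j *v x) \<bullet> (N' j *v x))"
  shows "c * (\<Sum>i\<in>I. mat_l2 (M i) u \<bullet> mat_l2 (N i) u) \<le> (\<Sum>j\<in>J. mat_l2 (M' j) u \<bullet> mat_l2 (N' j) u)"
proof -
  obtain f where f: "f \<in> L2" "u = abs_l2 f" by (rule l2_cases)
  have i: "integrable lborel (\<lambda>x. (M i *v f x) \<bullet> (N i *v f x))"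
    and j: "integrable lborel (\<lambda>x. (M' j *v f x) \<bullet> (N' j *v f x))" for i j
    using f by (auto intro!: L2_integrable_inner L2_mat)
  have "c * (\<Sum>i\<in>I. mat_l2 (M i) u \<bullet> mat_l2 (N i) u)
      = (LINT x|lborel. c * (\<Sum>i\<in>I. (M i *v f x) \<bullet> (N i *v f x)))"
    using f i by (simp add: mat_l2_abs abs_l2_inner L2_mat)
  also have "\<dots> \<le> (LINT x|lborel. (\<Sum>j\<in>J. (M' j *v f x) \<bullet> (N' j *v f x)))"
    using i j le by (intro integral_mono) auto
  also have "\<dots> = (\<Sum>j\<in>J. mat_l2 (M' j) u \<bullet> mat_l2 (N' j) u)"
    using f j by (simp add: mat_l2_abs abs_l2_inner L2_mat)
  finally show ?thesis .
qed

section \<open>Smooth functions and density of test functions\<close>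

definition smooth_fun :: "(real \<Rightarrow> real) \<Rightarrow> bool" where
  "smooth_fun f \<longleftrightarrow> (\<forall>k x. (deriv ^^ k) f differentiable at x)"

text \<open>No formula for higher derivatives is ever needed: it is enough to exhibit a set of
  differentiable functions that \<open>deriv\<close> maps into itself.\<close>

lemma smooth_fun_coinduct:
  assumes "f \<in> S" and "\<And>g x. g \<in> S \<Longrightarrow> g differentiable at x" and "\<And>g. g \<in> S \<Longrightarrow> deriv g \<in> S"
  shows "smooth_fun f"
proof -
  have "(deriv ^^ k) f \<in> S" for k
    by (induction k) (use assms in auto)
  with assms(2) show ?thesis by (auto simp: smooth_fun_def)
qed

lemma smooth_fun_differentiable: "smooth_fun f \<Longrightarrow> f differentiable at x"
  unfolding smooth_fun_def by (metis funpow_0)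

lemma smooth_fun_deriv: "smooth_fun f \<Longrightarrow> smooth_fun (deriv f)"
  unfolding smooth_fun_def by (metis funpow_Suc_right o_apply)

lemma smooth_fun_DERIV: "smooth_fun f \<Longrightarrow> (f has_real_derivative deriv f x) (at x)"
  using smooth_fun_differentiable DERIV_deriv_iff_real_differentiable by blast

lemma smooth_fun_continuous_on: "smooth_fun f \<Longrightarrow> continuous_on S f"
  by (meson DERIV_continuous_on DERIV_subset UNIV_I smooth_fun_DERIV subset_UNIV)

text \<open>The Leibniz rule turns a product into a sum of two products, so sums are included to
  make the set visibly stable under \<open>deriv\<close>, as \<open>smooth_fun_coinduct\<close>
  requires.\<close>

inductive_set smooth_products :: "(real \<Rightarrow> real) set" where
  prod: "smooth_fun f \<Longrightarrow> smooth_fun g \<Longrightarrow> (\<lambda>x. f x * g x) \<in> smooth_products"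
| add: "f \<in> smooth_products \<Longrightarrow> g \<in> smooth_products \<Longrightarrow> (\<lambda>x. f x + g x) \<in> smooth_products"

lemma smooth_products_deriv:
  "f \<in> smooth_products \<Longrightarrow> (\<forall>x. f differentiable at x) \<and> deriv f \<in> smooth_products"
proof (induction rule: smooth_products.induct)
  case (prod f g)
  have D: "((\<lambda>x. f x * g x) has_real_derivative (deriv f x * g x + f x * deriv g x)) (at x)" for x
    using prod by (auto intro!: derivative_eq_intros smooth_fun_DERIV)
  then have "deriv (\<lambda>x. f x * g x) = (\<lambda>x. deriv f x * g x + f x * deriv g x)"
    by (intro ext DERIV_imp_deriv)
  moreover have "\<dots> \<in> smooth_products"
    using prod by (intro smooth_products.intros smooth_fun_deriv)
  ultimately show ?case
    using D real_differentiable_def by auto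
next
  case (add f g)
  have D: "((\<lambda>x. f x + g x) has_real_derivative (deriv f x + deriv g x)) (at x)" for x
    using add by (auto intro!: derivative_eq_intros simp: DERIV_deriv_iff_real_differentiable)
  then have "deriv (\<lambda>x. f x + g x) = (\<lambda>x. deriv f x + deriv g x)"
    by (intro ext DERIV_imp_deriv)
  moreover have "\<dots> \<in> smooth_products"
    using add by (intro smooth_products.intros) auto
  ultimately show ?case
    using D real_differentiable_def by auto
qed

lemma smooth_fun_mult: "smooth_fun f \<Longrightarrow> smooth_fun g \<Longrightarrow> smooth_fun (\<lambda>x. f x * g x)"
  by (rule smooth_fun_coinduct[of _ smooth_products])
     (use smooth_products_deriv smooth_products.prod in auto)

lemma smooth_fun_affine:
  assumes "smooth_fun f"
  shows "smooth_fun (\<lambda>x. f (a * x + b))"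
proof (rule smooth_fun_coinduct)
  \<comment> \<open>The factor \<open>c\<close> collects the powers of \<open>a\<close> produced by
    the chain rule.\<close>
  let ?S = "{h. \<exists>g c. smooth_fun g \<and> h = (\<lambda>x. c * g (a * x + b))}"
  show "(\<lambda>x. f (a * x + b)) \<in> ?S"
    using assms by (auto intro!: exI[of _ f] exI[of _ 1])
  fix h assume "h \<in> ?S"
  then obtain g c where g: "smooth_fun g" and h: "h = (\<lambda>x. c * g (a * x + b))" by auto
  have D: "(h has_real_derivative (c * a * deriv g (a * x + b))) (at x)" for x
    unfolding h by (auto intro!: derivative_eq_intros DERIV_chain2[OF smooth_fun_DERIV[OF g]])
  then show "h differentiable at x" for x
    using real_differentiable_def by blast
  have "deriv h = (\<lambda>x. (c * a) * deriv g (a * x + b))"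
    using D by (intro ext DERIV_imp_deriv)
  then show "deriv h \<in> ?S"
    using smooth_fun_deriv[OF g] by blast
qed

lemma smooth_fun_polynomial:
  assumes "real_polynomial_function p"
  shows "smooth_fun p"
proof (rule smooth_fun_coinduct)
  show "p \<in> Collect real_polynomial_function" using assms by simp
  fix q :: "real \<Rightarrow> real" assume "q \<in> Collect real_polynomial_function"
  then obtain q' where "real_polynomial_function q'" and D: "\<And>x. (q has_real_derivative q' x) (at x)"
    using has_real_derivative_polynomial_function by blast
  moreover have "deriv q = q'"
    using D by (intro ext DERIV_imp_deriv)
  ultimately show "deriv q \<in> Collect real_polynomial_function" "q differentiable at x" for x
    using real_differentiable_def by auto
qed

section \<open>Flat functions and smooth cutoffs\<close>

definition flat_poly :: "real poly \<Rightarrow> real \<Rightarrow> real" where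
  "flat_poly p x = (if x > 0 then poly p (1 / x) * exp (- (1 / x)) else 0)"

lemma poly_times_exp_minus_tendsto_0: "((\<lambda>y. poly p y * exp (- y)) \<longlongrightarrow> (0::real)) at_top"
proof -
  \<comment> \<open>The extra factor \<open>y ^ k\<close> makes the induction close: each
    \<open>pCons\<close> moves one power of y into it.\<close>
  have "((\<lambda>y. poly p y * (y ^ k / exp y)) \<longlongrightarrow> (0::real)) at_top" for k
  proof (induction p arbitrary: k)
    case 0
    then show ?case by simp
  next
    case (pCons a p)
    have "((\<lambda>y. a * (y ^ k / exp y) + poly p y * (y ^ Suc k / exp y)) \<longlongrightarrow> a * 0 + 0) at_top"
      by (intro tendsto_add tendsto_mult tendsto_const pCons.IH tendsto_power_div_exp_0)
    then show ?case by (simp add: algebra_simps)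
  qed
  from this[of 0] show ?thesis by (simp add: exp_minus field_simps)
qed

text \<open>With y = 1/x, dy/dx = - y^2, so p(y) exp(-y) has derivative y^2 (p - p')(y) exp(-y), and
  \<open>[:0, 0, 1:]\<close> is y^2. Thus the derivatives of the classical flat function
  \<open>flat_poly 1\<close> never leave this family.\<close>

lemma DERIV_flat_poly:
  "(flat_poly p has_real_derivative flat_poly ([:0, 0, 1:] * (p - pderiv p)) x) (at x)"
proof -
  let ?q = "[:0, 0, 1:] * (p - pderiv p)"
  consider "x > 0" | "x < 0" | "x = 0" by linarith
  then show ?thesis
  proof cases
    case 1
    have "((\<lambda>x. poly p (1 / x) * exp (- (1 / x))) has_real_derivative flat_poly ?q x) (at x)"
      using 1
      by (auto intro!: derivative_eq_intros DERIV_chain2[OF poly_DERIV]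
        simp: flat_poly_def power2_eq_square field_simps)
    then show ?thesis
      by (rule has_field_derivative_transform_within_open[where S = "{0<..}"])
         (use 1 in \<open>auto simp: flat_poly_def\<close>)
  next
    case 2
    have "((\<lambda>x. 0) has_real_derivative flat_poly ?q x) (at x)"
      using 2 by (simp add: flat_poly_def)
    then show ?thesis
      by (rule has_field_derivative_transform_within_open[where S = "{..<0}"])
         (use 2 in \<open>auto simp: flat_poly_def\<close>)
  next
    case 3
    \<comment> \<open>The difference quotient at 0 from the right has one more factor 1/y, which is
      absorbed by passing from \<open>p\<close> to \<open>pCons 0 p\<close>.\<close>
    have "((\<lambda>y. poly (pCons 0 p) (inverse y) * exp (- inverse y)) \<longlongrightarrow> 0) (at_right 0)"
      by (rule filterlim_compose[OF poly_times_exp_minus_tendsto_0 filterlim_inverse_at_top_right])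
    moreover have "\<forall>\<^sub>F y in at_right 0.
        poly (pCons 0 p) (inverse y) * exp (- inverse y) = (flat_poly p y - flat_poly p 0) / (y - 0)"
      by (auto simp: eventually_at_right_field flat_poly_def field_simps intro!: exI[of _ 1])
    ultimately have "((\<lambda>y. (flat_poly p y - flat_poly p 0) / (y - 0)) \<longlongrightarrow> 0) (at_right 0)"
      by (rule Lim_transform_eventually)
    moreover have "((\<lambda>y. (flat_poly p y - flat_poly p 0) / (y - 0)) \<longlongrightarrow> 0) (at_left 0)"
      by (rule tendsto_eventually)
         (auto simp: eventually_at_left_field flat_poly_def intro!: exI[of _ "-1"])
    ultimately have "((\<lambda>y. (flat_poly p y - flat_poly p 0) / (y - 0)) \<longlongrightarrow> 0) (at 0)"
      by (simp add: filterlim_split_at)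
    then show ?thesis
      using 3 by (simp add: has_field_derivative_iff flat_poly_def)
  qed
qed

lemma smooth_fun_flat_poly: "smooth_fun (flat_poly p)"
proof (rule smooth_fun_coinduct)
  show "flat_poly p \<in> range flat_poly" by simp
  fix g assume "g \<in> range flat_poly"
  then obtain q where g: "g = flat_poly q" by blast
  show "g differentiable at x" for x
    unfolding g using DERIV_flat_poly real_differentiable_def by blast
  show "deriv g \<in> range flat_poly"
    unfolding g using DERIV_imp_deriv[OF DERIV_flat_poly] by (metis ext rangeI)
qed

text \<open>Large \<open>j\<close> steepens the cutoff: exp(-1/(j y)) tends to 1 for y > 0, while
  the function keeps vanishing outside the open interval. The arguments are written in the expanded
  form that \<open>smooth_fun_affine\<close> expects.\<close>

definition bump :: "real \<Rightarrow> nat \<Rightarrow> real \<Rightarrow> real" where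
  "bump N j x = flat_poly 1 (real j * x + real j * N) * flat_poly 1 (- real j * x + real j * N)"

lemma smooth_fun_bump: "smooth_fun (bump N j)"
  unfolding bump_def[abs_def] by (intro smooth_fun_mult smooth_fun_affine smooth_fun_flat_poly)

lemma flat_poly_1_bounds: "0 \<le> flat_poly 1 x" "flat_poly 1 x \<le> 1"
  by (auto simp: flat_poly_def)

lemma bump_bounds: "0 \<le> bump N j x" "bump N j x \<le> 1"
  by (auto simp: bump_def flat_poly_1_bounds intro: mult_le_one)

lemma bump_eq_0:
  assumes "x \<notin> {-N<..<N}"
  shows "bump N j x = 0"
proof -
  have "real j * x + real j * N = real j * (x + N)" "- real j * x + real j * N = real j * (N - x)"
    by (auto simp: algebra_simps)
  then show ?thesis
    using assms by (auto simp: bump_def flat_poly_def zero_less_mult_iff)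
qed

lemma bump_tendsto: "(\<lambda>j. bump N j x) \<longlonglongrightarrow> indicator {-N<..<N} x"
proof -
  have *: "(\<lambda>j. flat_poly 1 (real j * y)) \<longlonglongrightarrow> (if y > 0 then 1 else 0)" for y
  proof (cases "y > 0")
    case True
    have "(\<lambda>j. exp (- (1 / y * inverse (real j)))) \<longlonglongrightarrow> exp (- (1 / y * 0))"
      by (intro tendsto_intros lim_inverse_n)
    moreover have "\<forall>\<^sub>F j in sequentially. exp (- (1 / y * inverse (real j))) = flat_poly 1 (real j * y)"
      using eventually_gt_at_top[of 0] by eventually_elim (use True in \<open>auto simp: flat_poly_def field_simps\<close>)
    ultimately show ?thesis
      using True by (auto intro: Lim_transform_eventually)
  next
    case False
    then show ?thesis by (auto simp: flat_poly_def zero_less_mult_iff)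
  qed
  have "(\<lambda>j. flat_poly 1 (real j * (x + N)) * flat_poly 1 (real j * (N - x)))
      \<longlonglongrightarrow> (if x + N > 0 then 1 else 0) * (if N - x > 0 then 1 else 0)"
    by (intro tendsto_mult *)
  then show ?thesis
    by (simp add: bump_def[abs_def] algebra_simps indicator_def split: if_splits)
qed

subsection \<open>Vector-valued test functions\<close>

definition vtest :: "(real \<Rightarrow> 'e::euclidean_space) \<Rightarrow> bool" where
  "vtest \<Phi> \<longleftrightarrow> (\<forall>b\<in>Basis. test_function (\<lambda>x. \<Phi> x \<bullet> b))"

lemma test_functionI:
  assumes "smooth_fun f" and "\<And>x. x \<notin> {-N<..<N} \<Longrightarrow> f x = 0"
  shows "test_function f"
proof -
  have "{x. f x \<noteq> 0} \<subseteq> {-N<..<N}" using assms by blast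
  then have "bounded {x. f x \<noteq> 0}"
    by (rule bounded_subset[rotated]) (rule bounded_subset[OF compact_imp_bounded[OF compact_Icc[of "-N" N]]], auto)
  then show ?thesis
    using assms by (simp add: test_function_def smooth_fun_def)
qed

lemma test_function_smooth: "test_function f \<Longrightarrow> smooth_fun f"
  by (simp add: test_function_def smooth_fun_def)

lemma vtest_bump_polynomial:
  assumes "polynomial_function p"
  shows "vtest (\<lambda>x. bump N j x *\<^sub>R p x)"
  unfolding vtest_def
proof
  fix b :: 'a assume "b \<in> Basis"
  have "real_polynomial_function (\<lambda>x. p x \<bullet> b)"
    using assms bounded_linear_inner_left[of b] by (auto simp: polynomial_function_def o_def)
  then have "smooth_fun (\<lambda>x. bump N j x * (p x \<bullet> b))"
    by (intro smooth_fun_mult smooth_fun_bump smooth_fun_polynomial)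
  then show "test_function (\<lambda>x. (bump N j x *\<^sub>R p x) \<bullet> b)"
    by (auto intro!: test_functionI[of _ N] simp: bump_eq_0)
qed

lemma integrable_indicator_Icc:
  fixes a b :: real
  shows "integrable lborel (\<lambda>x. c * indicator {a..b} x :: real)"
  by (intro integrable_mult_right integrable_real_indicator) (auto simp: emeasure_lborel_Icc_eq)

lemma L2_bounded_support:
  fixes f :: "real \<Rightarrow> 'e::euclidean_space"
  assumes "f \<in> borel_measurable borel" "\<And>x. norm (f x) \<le> K * indicator {-N..N} x"
  shows "f \<in> L2"
proof -
  have [measurable]: "f \<in> borel_measurable borel" by fact
  have "integrable lborel (\<lambda>x. K\<^sup>2 * indicator {-N..N} x :: real)"
    by (rule integrable_indicator_Icc)
  moreover have "(norm (f x))\<^sup>2 \<le> K\<^sup>2 * indicator {-N..N} x" for x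
    using power_mono[OF assms(2)[of x] norm_ge_zero, of 2] by (auto simp: indicator_def split: if_splits)
  ultimately have "integrable lborel (\<lambda>x. (norm (f x))\<^sup>2)"
    by - (erule integrable_lborel_bound, auto)
  then show ?thesis by (simp add: L2_def)
qed

lemma dominated_L2_convergence:
  fixes f :: "real \<Rightarrow> 'e::euclidean_space"
  assumes f: "f \<in> L2" and s: "\<And>n. s n \<in> L2"
    and lim: "AE x in lborel. (\<lambda>n. s n x) \<longlonglongrightarrow> f x"
    and w: "integrable lborel w"
    and le: "\<And>n. AE x in lborel. (norm (s n x - f x))\<^sup>2 \<le> w x"
  shows "(\<lambda>n. L2_norm (\<lambda>x. s n x - f x)) \<longlonglongrightarrow> 0"
proof -
  have [measurable]: "f \<in> borel_measurable borel" "s n \<in> borel_measurable borel" for n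
    using f s by (auto simp: L2_def)
  have "(\<lambda>n. LINT x|lborel. (norm (s n x - f x))\<^sup>2) \<longlonglongrightarrow> integral\<^sup>L (lborel :: real measure) (\<lambda>x. 0 :: real)"
  proof (rule integral_dominated_convergence[OF _ _ w])
    show "AE x in lborel. (\<lambda>n. (norm (s n x - f x))\<^sup>2) \<longlonglongrightarrow> 0"
      using lim
    proof eventually_elim
      case (elim x)
      then have "(\<lambda>n. (norm (s n x - f x))\<^sup>2) \<longlonglongrightarrow> (norm (f x - f x))\<^sup>2"
        by (intro tendsto_intros)
      then show ?case by simp
    qed
  qed (use le in auto)
  then have "(\<lambda>n. sqrt (LINT x|lborel. (norm (s n x - f x))\<^sup>2)) \<longlonglongrightarrow> sqrt 0"
    by (intro tendsto_real_sqrt) simp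
  then show ?thesis by (simp add: L2_norm_def)
qed

text \<open>Instead of mollifiers, \<open>g\<close> is approximated almost everywhere by continuous
  functions, these uniformly on the interval by polynomials, and the polynomials are cut off by
  bumps. A uniform bound and bounded support let dominated convergence give the L2 limit.\<close>

lemma vtest_L2_dense_bounded:
  fixes g :: "real \<Rightarrow> 'e::euclidean_space"
  assumes [measurable]: "g \<in> borel_measurable borel"
    and K: "K \<ge> 0" and g_le: "\<And>x. norm (g x) \<le> K * indicator {-N..N} x"
  obtains s where "\<And>n. vtest (s n)" "\<And>n. s n \<in> L2" "(\<lambda>n. L2_norm (\<lambda>x. s n x - g x)) \<longlonglongrightarrow> 0"
proof -
  have "g measurable_on UNIV"
    by (subst measurable_on_iff_borel_measurable)
       (auto intro!: measurable_restrict_space1 measurable_completion)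
  then obtain Z G where Z: "negligible Z" and cG: "\<And>n. continuous_on UNIV (G n)"
    and G: "\<And>x. x \<notin> Z \<Longrightarrow> (\<lambda>n. G n x) \<longlonglongrightarrow> g x"
    unfolding measurable_on_def by auto
  \<comment> \<open>Projection onto the ball is a continuous truncation: it provides the dominating
    bound and leaves the limit unchanged, since \<open>g\<close> already takes values in the
    ball.\<close>
  define H where "H n x = closest_point (cball 0 K) (G n x)" for n :: nat and x
  have cc: "continuous_on t (closest_point (cball (0::'e) K))" for t
    using K by (intro continuous_on_closest_point) auto
  have cH: "continuous_on UNIV (H n)" for n
    unfolding H_def by (rule continuous_on_compose2[OF cc[of UNIV] cG]) auto
  have H_le: "norm (H n x) \<le> K" for n x
    using closest_point_in_set[of "cball (0::'e) K" "G n x"] K by (simp add: H_def)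
  have g_le': "norm (g x) \<le> K" for x
    using g_le[of x] K by (cases "x \<in> {-N..N}") auto
  have H: "(\<lambda>n. H n x) \<longlonglongrightarrow> g x" if "x \<notin> Z" for x
  proof -
    have "(\<lambda>n. closest_point (cball 0 K) (G n x)) \<longlonglongrightarrow> closest_point (cball 0 K) (g x)"
      by (rule continuous_on_tendsto_compose[OF cc[of UNIV] G[OF that]]) auto
    then show ?thesis
      using closest_point_self[of "g x" "cball 0 K"] g_le'[of x] by (simp add: H_def)
  qed
  have "\<exists>p. polynomial_function p \<and> (\<forall>x\<in>{-N..N}. norm (H n x - p x) < 1 / real (Suc n))" for n
    by (rule Stone_Weierstrass_polynomial_function)
       (auto intro: continuous_on_subset[OF cH])
  then obtain p where p: "\<And>n. polynomial_function (p n)"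
    and p_near: "\<And>n x. x \<in> {-N..N} \<Longrightarrow> norm (H n x - p n x) < 1 / real (Suc n)"
    by metis
  define s where "s n x = bump N n x *\<^sub>R p n x" for n x
  have s_0: "s n x = 0" if "x \<notin> {-N<..<N}" for n x
    using that by (simp add: s_def bump_eq_0)
  have s_le: "norm (s n x) \<le> (K + 1) * indicator {-N..N} x" for n x
  proof (cases "x \<in> {-N..N}")
    case True
    have "norm (p n x) \<le> norm (H n x) + norm (H n x - p n x)"
      using norm_triangle_sub[of "p n x" "H n x"] by (simp add: norm_minus_commute)
    also have "\<dots> \<le> K + 1 / real (Suc n)"
      using H_le[of n x] p_near[OF True, of n] by simp
    also have "\<dots> \<le> K + 1" by simp
    finally have "norm (p n x) \<le> K + 1" .
    then have "bump N n x * norm (p n x) \<le> 1 * (K + 1)"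
      using bump_bounds[of N n x] by (intro mult_mono) auto
    with True show ?thesis
      using bump_bounds[of N n x] by (simp add: s_def)
  next
    case False
    then show ?thesis using s_0[of x n] by auto
  qed
  have ms: "s n \<in> borel_measurable borel" for n
    unfolding s_def
    by (intro borel_measurable_continuous_onI continuous_on_scaleR smooth_fun_continuous_on
        smooth_fun_bump continuous_on_polymonial_function p)
  have sL2: "s n \<in> L2" for n
    by (rule L2_bounded_support[OF ms s_le])
  have gL2: "g \<in> L2"
    by (rule L2_bounded_support[OF _ g_le]) simp
  have vt: "vtest (s n)" for n
    unfolding s_def by (rule vtest_bump_polynomial[OF p])
  have "(\<lambda>n. L2_norm (\<lambda>x. s n x - g x)) \<longlonglongrightarrow> 0"
  proof (rule dominated_L2_convergence[OF gL2 sL2])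
    have "AE x in lborel. x \<notin> Z"
      using Z unfolding negligible_iff_null_sets
      by (subst AE_completion_iff[symmetric]) (rule AE_not_in)
    \<comment> \<open>The bumps converge to the indicator of the open interval whereas
      \<open>g\<close> lives on the closed one, so the two endpoints are discarded as null
      sets.\<close>
    moreover have "AE x in lborel. x \<noteq> N" "AE x in lborel. x \<noteq> - N"
      by (rule AE_lborel_singleton)+
    ultimately show "AE x in lborel. (\<lambda>n. s n x) \<longlonglongrightarrow> g x"
    proof eventually_elim
      case (elim x)
      show ?case
      proof (cases "x \<in> {-N<..<N}")
        case True
        have "(\<lambda>n. H n x - p n x) \<longlonglongrightarrow> 0"
          by (rule LIMSEQ_norm_0) (use p_near True in force)
        then have "(\<lambda>n. H n x - (H n x - p n x)) \<longlonglongrightarrow> g x - 0"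
          by (intro tendsto_diff H elim)
        then have "(\<lambda>n. bump N n x *\<^sub>R p n x) \<longlonglongrightarrow> indicator {-N<..<N} x *\<^sub>R g x"
          by (intro tendsto_scaleR bump_tendsto) simp
        then show ?thesis using True by (simp add: s_def)
      next
        case False
        then have "x \<notin> {-N..N}" using elim by auto
        then have "g x = 0" using g_le[of x] by simp
        then show ?thesis using s_0[OF False] by simp
      qed
    qed
    show "integrable lborel (\<lambda>x. (K + 1 + K)\<^sup>2 * indicator {-N..N} x :: real)"
      by (rule integrable_indicator_Icc)
    show "AE x in lborel. (norm (s n x - g x))\<^sup>2 \<le> (K + 1 + K)\<^sup>2 * indicator {-N..N} x" for n
    proof (rule AE_I2)
      fix x
      have "norm (s n x - g x) \<le> (K + 1) * indicator {-N..N} x + K * indicator {-N..N} x"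
        using norm_triangle_ineq4[of "s n x" "g x"] s_le[of n x] g_le[of x] by linarith
      from power_mono[OF this norm_ge_zero, of 2]
      show "(norm (s n x - g x))\<^sup>2 \<le> (K + 1 + K)\<^sup>2 * indicator {-N..N} x"
        by (auto simp: indicator_def split: if_splits)
    qed
  qed
  with vt sL2 show ?thesis by (rule that)
qed

lemma vtest_dense:
  fixes u :: "'e::euclidean_space l2"
  assumes "\<epsilon> > 0"
  obtains \<Phi> where "vtest \<Phi>" "\<Phi> \<in> L2" "norm (abs_l2 \<Phi> - u) < \<epsilon>"
proof -
  obtain f where f: "f \<in> L2" "u = abs_l2 f" by (rule l2_cases)
  then have [measurable]: "f \<in> borel_measurable borel" by (simp add: L2_def)
  \<comment> \<open>Values and support are truncated at the same level, so that the bounded case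
    applies with both \<open>K\<close> and \<open>N\<close> equal to \<open>n\<close>.\<close>
  define g where "g n x = (if norm (f x) \<le> real n \<and> x \<in> {- real n..real n} then f x else 0)" for n x
  have gm[measurable]: "g n \<in> borel_measurable borel" for n
    unfolding g_def by measurable
  have g_le: "norm (g n x) \<le> real n * indicator {- real n..real n} x" for n x
    by (simp add: g_def)
  have gL2: "g n \<in> L2" for n
    by (rule L2_bounded_support[OF gm g_le])
  have "(\<lambda>n. L2_norm (\<lambda>x. g n x - f x)) \<longlonglongrightarrow> 0"
  proof (rule dominated_L2_convergence[OF f(1) gL2])
    show "AE x in lborel. (\<lambda>n. g n x) \<longlonglongrightarrow> f x"
    proof (rule AE_I2)
      fix x
      have "\<forall>\<^sub>F n in sequentially. f x = g n x"
        using eventually_ge_at_top[of "nat \<lceil>max (norm (f x)) \<bar>x\<bar>\<rceil>"]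
      proof eventually_elim
        case (elim n)
        then have "max (norm (f x)) \<bar>x\<bar> \<le> real n" by linarith
        then show ?case by (auto simp: g_def)
      qed
      then show "(\<lambda>n. g n x) \<longlonglongrightarrow> f x"
        by (rule Lim_transform_eventually[OF tendsto_const])
    qed
    show "integrable lborel (\<lambda>x. (norm (f x))\<^sup>2)" using f by (simp add: L2_def)
  qed (auto simp: g_def)
  then have "\<forall>\<^sub>F n in sequentially. L2_norm (\<lambda>x. g n x - f x) < \<epsilon> / 2"
    using assms by (intro order_tendstoD) auto
  then obtain n where n: "L2_norm (\<lambda>x. g n x - f x) < \<epsilon> / 2"
    by (auto simp: eventually_sequentially)
  obtain s where s: "\<And>n. vtest (s n)" "\<And>n. s n \<in> L2"
    and "(\<lambda>k. L2_norm (\<lambda>x. s k x - g n x)) \<longlonglongrightarrow> 0"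
    by (rule vtest_L2_dense_bounded[OF gm _ g_le]) auto
  then have "\<forall>\<^sub>F k in sequentially. L2_norm (\<lambda>x. s k x - g n x) < \<epsilon> / 2"
    using assms by (intro order_tendstoD) auto
  then obtain k where k: "L2_norm (\<lambda>x. s k x - g n x) < \<epsilon> / 2"
    by (auto simp: eventually_sequentially)
  have "norm (abs_l2 (s k) - u) \<le> norm (abs_l2 (s k) - abs_l2 (g n)) + norm (abs_l2 (g n) - u)"
    using norm_triangle_ineq[of "abs_l2 (s k) - abs_l2 (g n)" "abs_l2 (g n) - u"] by simp
  also have "\<dots> < \<epsilon>"
    using n k f by (simp add: abs_l2_diff norm_abs_l2 gL2 s L2_diff)
  finally show ?thesis by (rule that[OF s])
qed

section \<open>The generator of the translation group\<close>

lemmas shift_diff = linear_diff[OF linear_shift]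
lemmas shift_scaleR = linear_scale[OF linear_shift]

lemmas mat_l2_diff = linear_diff[OF linear_mat_l2]
lemmas mat_l2_add = linear_add[OF linear_mat_l2]
lemmas mat_l2_scaleR = linear_scale[OF linear_mat_l2]

lemma L2_norm_mono:
  fixes f :: "real \<Rightarrow> 'a::euclidean_space" and g :: "real \<Rightarrow> 'b::euclidean_space"
  assumes "f \<in> L2" "g \<in> L2" "\<And>x. norm (f x) \<le> norm (g x)"
  shows "L2_norm f \<le> L2_norm g"
  unfolding L2_norm_def using assms by (auto simp: L2_def intro!: integral_mono power_mono)

lemma L2_norm_scaleR: "f \<in> L2 \<Longrightarrow> L2_norm (\<lambda>x. c *\<^sub>R f x) = \<bar>c\<bar> * L2_norm f"
  by (metis L2_scaleR abs_l2_scaleR norm_abs_l2 norm_scaleR)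

lemma bounded_linear_mat_l2: "bounded_linear (mat_l2 M)"
proof -
  obtain K where K: "\<And>x. norm (M *v x) \<le> norm x * K"
    using bounded_linear.bounded[OF matrix_vector_mul_bounded_linear[of M]] by auto
  show ?thesis
  proof (rule bounded_linear_intro[where K = "\<bar>K\<bar>"])
    fix u :: "(real ^ 'a) l2"
    obtain f where f: "f \<in> L2" "u = abs_l2 f" by (rule l2_cases)
    have "norm (M *v f x) \<le> norm (K *\<^sub>R f x)" for x
      using order_trans[OF K[of "f x"] mult_left_mono[OF abs_ge_self norm_ge_zero]]
      by (simp add: mult.commute)
    then have "L2_norm (\<lambda>x. M *v f x) \<le> L2_norm (\<lambda>x. K *\<^sub>R f x)"
      using f by (intro L2_norm_mono L2_mat L2_scaleR)
    then show "norm (mat_l2 M u) \<le> norm u * \<bar>K\<bar>"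
      using f by (simp add: mat_l2_abs norm_abs_l2 L2_mat L2_norm_scaleR mult.commute)
  qed (simp_all add: mat_l2_add mat_l2_scaleR)
qed

lemma has_vector_derivative_quotient:
  assumes "((\<lambda>y. (1 / (y - x)) *\<^sub>R (f y - f x)) \<longlongrightarrow> f') (at x within S)"
  shows "(f has_vector_derivative f') (at x within S)"
proof -
  have "((\<lambda>y. (1 / (y - x)) *\<^sub>R (f y - f x) - f') \<longlongrightarrow> 0) (at x within S)"
    using assms by (rule LIM_zero)
  then have "((\<lambda>y. norm ((1 / (y - x)) *\<^sub>R (f y - f x) - f')) \<longlongrightarrow> 0) (at x within S)"
    by (rule tendsto_norm_zero)
  moreover have "\<forall>\<^sub>F y in at x within S. norm ((1 / (y - x)) *\<^sub>R (f y - f x) - f')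
      = norm ((f y - f x - (y - x) *\<^sub>R f') /\<^sub>R norm (y - x))"
    unfolding eventually_at_filter
  proof (rule always_eventually, intro allI impI)
    fix y assume "y \<noteq> x"
    then have "(1 / (y - x)) *\<^sub>R (f y - f x) - f' = (1 / (y - x)) *\<^sub>R (f y - f x - (y - x) *\<^sub>R f')"
      by (simp add: scaleR_diff_right)
    then show "norm ((1 / (y - x)) *\<^sub>R (f y - f x) - f')
        = norm ((f y - f x - (y - x) *\<^sub>R f') /\<^sub>R norm (y - x))"
      by (simp add: divide_inverse)
  qed
  ultimately have "((\<lambda>y. norm ((f y - f x - (y - x) *\<^sub>R f') /\<^sub>R norm (y - x))) \<longlongrightarrow> 0) (at x within S)"
    by (rule Lim_transform_eventually)
  then show ?thesis
    unfolding has_vector_derivative_def has_derivative_at_within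
    by (auto intro: tendsto_norm_zero_cancel bounded_linear_scaleR_left)
qed

text \<open>The graph of the generator of the translation group. The limit is taken in norm, so
  bounded operators and inner products pass through it.\<close>

definition l2_deriv :: "'e::euclidean_space l2 \<Rightarrow> 'e l2 \<Rightarrow> bool" where
  "l2_deriv u p \<longleftrightarrow> ((\<lambda>h. (1 / h) *\<^sub>R (shift h u - u)) \<longlongrightarrow> p) (at 0)"

lemma l2_deriv_unique: "l2_deriv u p \<Longrightarrow> l2_deriv u q \<Longrightarrow> p = q"
  unfolding l2_deriv_def by (rule tendsto_unique[rotated]) auto

lemma l2_deriv_diff: "l2_deriv u p \<Longrightarrow> l2_deriv w q \<Longrightarrow> l2_deriv (u - w) (p - q)"
  unfolding l2_deriv_def
  by (drule (1) tendsto_diff) (simp add: shift_diff algebra_simps)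

lemma l2_deriv_scaleR: "l2_deriv u p \<Longrightarrow> l2_deriv (c *\<^sub>R u) (c *\<^sub>R p)"
  unfolding l2_deriv_def
  by (drule tendsto_scaleR[OF tendsto_const, of _ _ _ c]) (simp add: shift_scaleR algebra_simps)

lemma l2_deriv_shift: "l2_deriv u p \<Longrightarrow> l2_deriv (shift k u) (shift k p)"
  unfolding l2_deriv_def
  by (drule bounded_linear.tendsto[OF bounded_linear_shift[of k]])
     (simp add: shift_diff shift_scaleR shift_shift add.commute)

lemma l2_deriv_mat: "l2_deriv u p \<Longrightarrow> l2_deriv (mat_l2 M u) (mat_l2 M p)"
  unfolding l2_deriv_def
  by (drule bounded_linear.tendsto[OF bounded_linear_mat_l2[of M]])
     (simp add: mat_l2_diff mat_l2_scaleR shift_mat_l2)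

lemma filterlim_uminus_at_0: "filterlim (\<lambda>h::real. - h) (at 0) (at 0)"
  by (auto simp: filterlim_at eventually_at intro!: tendsto_eq_intros exI[of _ 1])

text \<open>The adjoint of \<open>shift h\<close> is \<open>shift (- h)\<close>, so the difference
  quotient with step h moves to the other factor as minus the quotient with step -h. In the limit
  the generator is skew-adjoint.\<close>

lemma l2_deriv_inner_by_parts:
  assumes "l2_deriv u p" "l2_deriv w q"
  shows "p \<bullet> w = - (u \<bullet> q)"
proof -
  have "((\<lambda>h. ((1 / h) *\<^sub>R (shift h u - u)) \<bullet> w) \<longlongrightarrow> p \<bullet> w) (at 0)"
    using assms(1) unfolding l2_deriv_def by (intro tendsto_intros)
  moreover have "((\<lambda>h. - (u \<bullet> ((1 / h) *\<^sub>R (shift h w - w)))) \<longlongrightarrow> - (u \<bullet> q)) (at 0)"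
    using assms(2) unfolding l2_deriv_def by (intro tendsto_intros)
  then have "((\<lambda>h. - (u \<bullet> ((1 / - h) *\<^sub>R (shift (- h) w - w)))) \<longlongrightarrow> - (u \<bullet> q)) (at 0)"
    by (rule filterlim_compose[OF _ filterlim_uminus_at_0])
  then have "((\<lambda>h. ((1 / h) *\<^sub>R (shift h u - u)) \<bullet> w) \<longlongrightarrow> - (u \<bullet> q)) (at 0)"
    by (simp add: inner_diff_left inner_diff_right inner_shift_left)
  ultimately show ?thesis by (rule tendsto_unique[rotated]) simp
qed

lemma l2_deriv_has_vector_derivative:
  assumes "l2_deriv u p"
  shows "((\<lambda>h. shift h u) has_vector_derivative shift h p) (at h)"
proof (rule has_vector_derivative_quotient)
  have "((\<lambda>k. (1 / k) *\<^sub>R (shift (h + k) u - shift h u)) \<longlongrightarrow> shift h p) (at 0)"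
    using l2_deriv_shift[OF assms, of h] by (simp add: l2_deriv_def shift_shift add.commute)
  then show "((\<lambda>y. (1 / (y - h)) *\<^sub>R (shift y u - shift h u)) \<longlongrightarrow> shift h p) (at h)"
    by (subst filterlim_at_to_0) (simp add: add.commute)
qed

text \<open>The curve of translates has velocity \<open>shift h p\<close>, of constant norm, so this
  is the mean value inequality. It later dominates difference quotients uniformly in the
  step.\<close>

lemma norm_shift_diff_le:
  assumes "l2_deriv u p"
  shows "norm (shift h u - u) \<le> \<bar>h\<bar> * norm p"
proof -
  have "norm (shift h u - shift 0 u) \<le> norm p * norm (h - 0)"
  proof (rule differentiable_bound[where S = UNIV and f' = "\<lambda>h k. k *\<^sub>R shift h p"])
    show "((\<lambda>h. shift h u) has_derivative (\<lambda>k. k *\<^sub>R shift x p)) (at x within UNIV)" for x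
      using l2_deriv_has_vector_derivative[OF assms, of x] by (simp add: has_vector_derivative_def)
    show "onorm (\<lambda>k. k *\<^sub>R shift x p) \<le> norm p" for x
      by (rule onorm_le) simp
  qed auto
  then show ?thesis by (simp add: mult.commute)
qed

subsection \<open>Test functions lie in the domain of the generator\<close>

definition vderiv :: "(real \<Rightarrow> 'e::euclidean_space) \<Rightarrow> real \<Rightarrow> 'e" where
  "vderiv \<Phi> x = (\<Sum>b\<in>Basis. deriv (\<lambda>x. \<Phi> x \<bullet> b) x *\<^sub>R b)"

lemma vderiv_inner: "b \<in> Basis \<Longrightarrow> vderiv \<Phi> x \<bullet> b = deriv (\<lambda>x. \<Phi> x \<bullet> b) x"
  by (simp add: vderiv_def)

lemma deriv_eq_0_outside:
  fixes f :: "real \<Rightarrow> real"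
  assumes "\<And>x. R < \<bar>x\<bar> \<Longrightarrow> f x = 0" and "R < \<bar>x\<bar>"
  shows "deriv f x = 0"
proof -
  have "(f has_real_derivative 0) (at x)"
  proof (rule has_field_derivative_transform_within_open[where f = "\<lambda>_. 0" and S = "{x. R < \<bar>x\<bar>}"])
    show "open {x::real. R < \<bar>x\<bar>}" by (intro open_Collect_less continuous_intros)
  qed (use assms in auto)
  then show ?thesis by (rule DERIV_imp_deriv)
qed

text \<open>Everything comes from compactness of the support. The Lipschitz bound for
  \<open>deriv \<phi>\<close> is a bound for the second derivative, and it is what controls the
  Taylor remainder.\<close>

lemma test_function_bounds:
  assumes "test_function \<phi>"
  obtains R K where "\<And>x. R < \<bar>x\<bar> \<Longrightarrow> \<phi> x = 0" "\<And>x. R < \<bar>x\<bar> \<Longrightarrow> deriv \<phi> x = 0"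
    "\<And>x. \<bar>\<phi> x\<bar> \<le> K" "\<And>x. \<bar>deriv \<phi> x\<bar> \<le> K"
    "\<And>x y. \<bar>deriv \<phi> x - deriv \<phi> y\<bar> \<le> K * \<bar>x - y\<bar>"
proof -
  have sm: "smooth_fun \<phi>" using assms by (rule test_function_smooth)
  have "bounded {x. \<phi> x \<noteq> 0}"
    using assms unfolding test_function_def
    by (meson bounded_subset closure_subset compact_imp_bounded)
  then obtain R where R: "\<And>x. \<phi> x \<noteq> 0 \<Longrightarrow> \<bar>x\<bar> \<le> R"
    by (auto simp: bounded_iff)
  have 0: "\<phi> x = 0" if "R < \<bar>x\<bar>" for x using R[of x] that by auto
  have 1: "deriv \<phi> x = 0" if "R < \<bar>x\<bar>" for x using deriv_eq_0_outside[OF 0 that] .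
  have 2: "deriv (deriv \<phi>) x = 0" if "R < \<bar>x\<bar>" for x using deriv_eq_0_outside[OF 1 that] .
  have bnd: "\<exists>K\<ge>0. \<forall>x. \<bar>f x\<bar> \<le> K" if f: "smooth_fun f" "\<And>x. R < \<bar>x\<bar> \<Longrightarrow> f x = 0" for f
  proof -
    have "bounded (f ` {-R..R})"
      by (intro compact_imp_bounded compact_continuous_image smooth_fun_continuous_on f) simp
    then obtain K where K: "\<And>x. x \<in> {-R..R} \<Longrightarrow> \<bar>f x\<bar> \<le> K"
      unfolding bounded_iff by (metis imageI real_norm_def)
    have "\<bar>f x\<bar> \<le> max 0 K" for x
    proof (cases "R < \<bar>x\<bar>")
      case False
      then have "x \<in> {-R..R}" by auto
      then show ?thesis using K[of x] by linarith
    qed (simp add: f(2))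
    then show ?thesis by (intro exI[of _ "max 0 K"]) auto
  qed
  obtain K0 where K0: "K0 \<ge> 0" "\<And>x. \<bar>\<phi> x\<bar> \<le> K0"
    using bnd[OF sm 0] by blast
  obtain K1 where K1: "K1 \<ge> 0" "\<And>x. \<bar>deriv \<phi> x\<bar> \<le> K1"
    using bnd[OF smooth_fun_deriv[OF sm] 1] by blast
  obtain K2 where K2: "K2 \<ge> 0" "\<And>x. \<bar>deriv (deriv \<phi>) x\<bar> \<le> K2"
    using bnd[OF smooth_fun_deriv[OF smooth_fun_deriv[OF sm]] 2] by blast
  show ?thesis
  proof (rule that[of R "K0 + K1 + K2"])
    show "\<phi> x = 0" "deriv \<phi> x = 0" if "R < \<bar>x\<bar>" for x
      using 0 1 that by auto
    show "\<bar>\<phi> x\<bar> \<le> K0 + K1 + K2" "\<bar>deriv \<phi> x\<bar> \<le> K0 + K1 + K2" for x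
      using K0(1) K0(2)[of x] K1(1) K1(2)[of x] K2(1) by linarith+
    fix x y
    have "norm (deriv \<phi> x - deriv \<phi> y) \<le> K2 * norm (x - y)"
      by (rule field_differentiable_bound[where S = UNIV and f' = "deriv (deriv \<phi>)"])
         (auto simp: K2 intro!: smooth_fun_DERIV smooth_fun_deriv sm)
    also have "\<dots> \<le> (K0 + K1 + K2) * norm (x - y)"
      using K0 K1 by (intro mult_right_mono) auto
    finally show "\<bar>deriv \<phi> x - deriv \<phi> y\<bar> \<le> (K0 + K1 + K2) * \<bar>x - y\<bar>" by simp
  qed
qed


text \<open>Mean value inequality for y \<mapsto> \<phi>(x + y) - y \<phi>'(x), whose derivative is
  at most K |h| as long as |y| \<le> |h|.\<close>

lemma test_function_Taylor:
  fixes \<phi> :: "real \<Rightarrow> real"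
  assumes \<phi>: "smooth_fun \<phi>" and K: "\<And>x y. \<bar>deriv \<phi> x - deriv \<phi> y\<bar> \<le> K * \<bar>x - y\<bar>" and "K \<ge> 0"
  shows "\<bar>\<phi> (x + h) - \<phi> x - h * deriv \<phi> x\<bar> \<le> K * \<bar>h\<bar> * \<bar>h\<bar>"
proof -
  have "norm ((\<phi> (x + h) - h * deriv \<phi> x) - (\<phi> (x + 0) - 0 * deriv \<phi> x)) \<le> (K * \<bar>h\<bar>) * norm (h - 0)"
  proof (rule field_differentiable_bound[where S = "{-\<bar>h\<bar>..\<bar>h\<bar>}" and f' = "\<lambda>y. deriv \<phi> (x + y) - deriv \<phi> x"])
    fix y :: real assume y: "y \<in> {-\<bar>h\<bar>..\<bar>h\<bar>}"
    show "((\<lambda>y. \<phi> (x + y) - y * deriv \<phi> x) has_field_derivative deriv \<phi> (x + y) - deriv \<phi> x)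
        (at y within {-\<bar>h\<bar>..\<bar>h\<bar>})"
      by (auto intro!: derivative_eq_intros DERIV_chain2[OF smooth_fun_DERIV[OF \<phi>]])
    have "K * \<bar>y\<bar> \<le> K * \<bar>h\<bar>"
      using y \<open>K \<ge> 0\<close> by (intro mult_left_mono) auto
    then show "norm (deriv \<phi> (x + y) - deriv \<phi> x) \<le> K * \<bar>h\<bar>"
      using K[of "x + y" x] by simp
  qed auto
  then show ?thesis by (simp add: algebra_simps)
qed

lemma L2_norm_bounded_support:
  fixes f :: "real \<Rightarrow> 'e::euclidean_space"
  assumes "f \<in> borel_measurable borel" "\<And>x. norm (f x) \<le> K * indicator {-N..N} x" "N \<ge> 0" "K \<ge> 0"
  shows "L2_norm f \<le> K * sqrt (2 * N)"
proof -
  have f: "f \<in> L2" by (rule L2_bounded_support[OF assms(1,2)])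
  have "(\<lambda>x. K * indicator {-N..N} x :: real) \<in> L2"
    by (rule L2_bounded_support[where K = K and N = N]) (use assms in auto)
  then have "L2_norm f \<le> L2_norm (\<lambda>x. K * indicator {-N..N} x :: real)"
    using f by (intro L2_norm_mono) (auto intro: order_trans[OF assms(2) abs_ge_self])
  also have "\<dots> = K * sqrt (2 * N)"
  proof -
    have "(LINT x|lborel. (norm (K * indicator {-N..N} x :: real))\<^sup>2) = (LINT x|lborel. K\<^sup>2 * indicator {-N..N} x)"
      by (intro Bochner_Integration.integral_cong) (auto simp: indicator_def)
    also have "\<dots> = K\<^sup>2 * (2 * N)"
      using assms by simp
    finally show ?thesis
      using assms by (simp add: L2_norm_def real_sqrt_mult)
  qed
  finally show ?thesis .
qed

text \<open>For |h| < 1 the error of the difference quotient vanishes outside a fixed interval, one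
  unit larger on each side than the support, and is bounded by C |h|. Its L2 norm is therefore
  O(|h|).\<close>

lemma vtest_l2_deriv:
  assumes "vtest \<Phi>"
  shows "\<Phi> \<in> L2" "vderiv \<Phi> \<in> L2" "l2_deriv (abs_l2 \<Phi>) (abs_l2 (vderiv \<Phi>))"
proof -
  let ?\<phi> = "\<lambda>b x. \<Phi> x \<bullet> b"
  have t: "test_function (?\<phi> b)" if "b \<in> Basis" for b
    using assms that by (simp add: vtest_def)
  then have sm: "smooth_fun (?\<phi> b)" if "b \<in> Basis" for b
    using that by (blast intro: test_function_smooth)
  have "\<forall>b\<in>Basis. \<exists>R K. (\<forall>x. R < \<bar>x\<bar> \<longrightarrow> ?\<phi> b x = 0 \<and> deriv (?\<phi> b) x = 0) \<and>
      (\<forall>x. \<bar>?\<phi> b x\<bar> \<le> K \<and> \<bar>deriv (?\<phi> b) x\<bar> \<le> K) \<and>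
      (\<forall>x y. \<bar>deriv (?\<phi> b) x - deriv (?\<phi> b) y\<bar> \<le> K * \<bar>x - y\<bar>)"
    using test_function_bounds[OF t] by metis
  then obtain R K where
    R: "\<And>b x. b \<in> Basis \<Longrightarrow> R b < \<bar>x\<bar> \<Longrightarrow> ?\<phi> b x = 0 \<and> deriv (?\<phi> b) x = 0" and
    K: "\<And>b x. b \<in> Basis \<Longrightarrow> \<bar>?\<phi> b x\<bar> \<le> K b \<and> \<bar>deriv (?\<phi> b) x\<bar> \<le> K b" and
    L: "\<And>b x y. b \<in> Basis \<Longrightarrow> \<bar>deriv (?\<phi> b) x - deriv (?\<phi> b) y\<bar> \<le> K b * \<bar>x - y\<bar>"
    by metis
  define S where "S = (\<Sum>b\<in>Basis. \<bar>R b\<bar>)"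
  define C where "C = (\<Sum>b\<in>Basis. K b)"
  have S0: "S \<ge> 0" unfolding S_def by (intro sum_nonneg) auto
  have K0: "K b \<ge> 0" if "b \<in> Basis" for b using K[OF that, of 0] by linarith
  have C0: "C \<ge> 0" unfolding C_def by (intro sum_nonneg K0)
  have RS: "R b \<le> S" if "b \<in> Basis" for b
    unfolding S_def using member_le_sum[of b Basis "\<lambda>b. \<bar>R b\<bar>"] that by auto
  have out: "\<Phi> x = 0" "vderiv \<Phi> x = 0" if "S < \<bar>x\<bar>" for x
  proof -
    have "R b < \<bar>x\<bar>" if "b \<in> Basis" for b
      using RS[OF that] \<open>S < \<bar>x\<bar>\<close> by linarith
    then show "\<Phi> x = 0" "vderiv \<Phi> x = 0"
      using R by (simp_all add: euclidean_eq_iff[where 'a = 'a] vderiv_inner)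
  qed
  have bnd: "norm (\<Phi> x) \<le> C" "norm (vderiv \<Phi> x) \<le> C" for x
    unfolding C_def using K
    by (auto intro!: order_trans[OF norm_le_l1] sum_mono simp: vderiv_inner)
  have supp: "norm (\<Phi> x) \<le> C * indicator {-S..S} x" "norm (vderiv \<Phi> x) \<le> C * indicator {-S..S} x" for x
    using bnd[of x] out[of x] by (cases "S < \<bar>x\<bar>"; simp add: indicator_def abs_le_iff; linarith)+
  have \<Phi>_eq: "\<Phi> = (\<lambda>x. \<Sum>b\<in>Basis. (\<Phi> x \<bullet> b) *\<^sub>R b)"
    by (simp add: euclidean_representation)
  have "continuous_on UNIV \<Phi>"
    by (subst \<Phi>_eq) (intro continuous_intros smooth_fun_continuous_on sm)
  then have m[measurable]: "\<Phi> \<in> borel_measurable borel"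
    by (rule borel_measurable_continuous_onI)
  have "continuous_on UNIV (vderiv \<Phi>)"
    unfolding vderiv_def by (intro continuous_intros smooth_fun_continuous_on smooth_fun_deriv sm)
  then have m'[measurable]: "vderiv \<Phi> \<in> borel_measurable borel"
    by (rule borel_measurable_continuous_onI)
  show L2: "\<Phi> \<in> L2"
    by (rule L2_bounded_support[OF m, of C S]) (use supp in auto)
  show L2': "vderiv \<Phi> \<in> L2"
    by (rule L2_bounded_support[OF m', of C S]) (use supp in auto)
  define q where "q h x = (1 / h) *\<^sub>R (\<Phi> (x + h) - \<Phi> x) - vderiv \<Phi> x" for h x
  have q_le: "norm (q h x) \<le> C * \<bar>h\<bar> * indicator {-(S + 1)..S + 1} x" if h: "h \<noteq> 0" "\<bar>h\<bar> < 1" for h x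
  proof (cases "x \<in> {-(S + 1)..S + 1}")
    case True
    have "\<bar>q h x \<bullet> b\<bar> \<le> K b * \<bar>h\<bar>" if b: "b \<in> Basis" for b
    proof -
      have "q h x \<bullet> b = (1 / h) * (?\<phi> b (x + h) - ?\<phi> b x - h * deriv (?\<phi> b) x)"
        using h b by (simp add: q_def vderiv_inner inner_diff_left algebra_simps)
      also have "\<bar>\<dots>\<bar> \<le> (1 / \<bar>h\<bar>) * (K b * \<bar>h\<bar> * \<bar>h\<bar>)"
        unfolding abs_mult
        using test_function_Taylor[OF sm[OF b] L[OF b] K0[OF b], of x h] by (intro mult_mono) auto
      also have "\<dots> = K b * \<bar>h\<bar>" using h by simp
      finally show ?thesis .
    qed
    then have "norm (q h x) \<le> (\<Sum>b\<in>Basis. K b * \<bar>h\<bar>)"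
      by (intro order_trans[OF norm_le_l1] sum_mono)
    then show ?thesis using True by (simp add: C_def sum_distrib_right)
  next
    case False
    then have "S < \<bar>x\<bar>" "S < \<bar>x + h\<bar>" using h by auto
    then show ?thesis using False by (simp add: q_def out)
  qed
  have qm: "q h \<in> borel_measurable borel" for h
    unfolding q_def by measurable
  have quot: "(1 / h) *\<^sub>R (shift h (abs_l2 \<Phi>) - abs_l2 \<Phi>) - abs_l2 (vderiv \<Phi>) = abs_l2 (q h)" for h
    using L2 L2' by (simp add: q_def[abs_def] shift_abs abs_l2_diff abs_l2_scaleR L2_translate[of \<Phi>]
        L2_diff L2_scaleR)
  have qL2: "q h \<in> L2" for h
    unfolding q_def[abs_def] using L2 L2' by (intro L2_diff L2_scaleR L2_translate[of \<Phi>])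
  have "((\<lambda>h. abs_l2 (q h)) \<longlongrightarrow> 0) (at 0)"
  proof (rule Lim_null_comparison)
    show "\<forall>\<^sub>F h in at 0. norm (abs_l2 (q h)) \<le> C * \<bar>h\<bar> * sqrt (2 * (S + 1))"
      unfolding eventually_at
    proof (intro exI[of _ 1] conjI ballI impI)
      fix h :: real assume "h \<noteq> 0 \<and> dist h 0 < 1"
      then show "norm (abs_l2 (q h)) \<le> C * \<bar>h\<bar> * sqrt (2 * (S + 1))"
        unfolding norm_abs_l2[OF qL2]
        by (intro L2_norm_bounded_support[OF qm q_le]) (use S0 C0 in auto)
    qed auto
    show "((\<lambda>h. C * \<bar>h\<bar> * sqrt (2 * (S + 1))) \<longlongrightarrow> 0) (at 0)"
      by (auto intro!: tendsto_eq_intros)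
  qed
  then show "l2_deriv (abs_l2 \<Phi>) (abs_l2 (vderiv \<Phi>))"
    unfolding l2_deriv_def quot[symmetric] by (rule LIM_zero_cancel)
qed

lemma vtest_translate:
  assumes "vtest \<Phi>"
  shows "vtest (\<lambda>x. \<Phi> (x + h))" "vderiv (\<lambda>x. \<Phi> (x + h)) = (\<lambda>x. vderiv \<Phi> (x + h))"
proof -
  have t: "test_function (\<lambda>x. \<Phi> x \<bullet> b)" if "b \<in> Basis" for b
    using assms that by (simp add: vtest_def)
  show "vtest (\<lambda>x. \<Phi> (x + h))"
    unfolding vtest_def
  proof
    fix b :: 'a assume b: "b \<in> Basis"
    obtain R where R: "\<And>x. R < \<bar>x\<bar> \<Longrightarrow> \<Phi> x \<bullet> b = 0"
      using test_function_bounds[OF t[OF b]] by metis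
    have "smooth_fun (\<lambda>x. \<Phi> (1 * x + h) \<bullet> b)"
      using smooth_fun_affine[OF test_function_smooth[OF t[OF b]], of 1 h] .
    then show "test_function (\<lambda>x. \<Phi> (x + h) \<bullet> b)"
      by (intro test_functionI[where N = "\<bar>R\<bar> + \<bar>h\<bar> + 1"]) (auto intro!: R)
  qed
  have "deriv (\<lambda>x. \<Phi> (x + h) \<bullet> b) x = deriv (\<lambda>x. \<Phi> x \<bullet> b) (x + h)" if "b \<in> Basis" for b x
    using smooth_fun_DERIV[OF test_function_smooth[OF t[OF that]], of "x + h"]
    by (intro DERIV_imp_deriv) (simp add: DERIV_shift)
  then show "vderiv (\<lambda>x. \<Phi> (x + h)) = (\<lambda>x. vderiv \<Phi> (x + h))"
    by (simp add: vderiv_def fun_eq_iff)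
qed


subsection \<open>Weak derivatives and the generator\<close>

lemma L2_integrable_scaleR:
  fixes f :: "real \<Rightarrow> real"
  assumes "f \<in> L2" "g \<in> L2"
  shows "integrable lborel (\<lambda>x. f x *\<^sub>R g x)"
proof -
  have [measurable]: "f \<in> borel_measurable borel" "g \<in> borel_measurable borel"
    using assms by (auto simp: L2_def)
  have "integrable lborel (\<lambda>x. (norm (f x))\<^sup>2 + (norm (g x))\<^sup>2)"
    using assms by (auto simp: L2_def)
  moreover have "norm (f x *\<^sub>R g x) \<le> (norm (f x))\<^sup>2 + (norm (g x))\<^sup>2" for x
  proof -
    have "\<bar>f x\<bar> * norm (g x) \<le> 2 * \<bar>f x\<bar> * norm (g x)" by simp
    also have "\<dots> \<le> \<bar>f x\<bar>\<^sup>2 + (norm (g x))\<^sup>2" by (rule sum_squares_bound)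
    finally show ?thesis by simp
  qed
  ultimately show ?thesis
    by - (erule integrable_lborel_bound, auto)
qed

lemma test_function_L2:
  assumes "test_function \<phi>"
  shows "\<phi> \<in> L2" "deriv \<phi> \<in> L2"
proof -
  have v: "vtest \<phi>" using assms by (simp add: vtest_def)
  show "\<phi> \<in> L2" using vtest_l2_deriv(1)[OF v] .
  have "vderiv \<phi> = deriv \<phi>" by (simp add: vderiv_def fun_eq_iff)
  then show "deriv \<phi> \<in> L2" using vtest_l2_deriv(2)[OF v] by simp
qed

text \<open>The scalar identity is tested with each coordinate of \<Phi> and read off in the
  corresponding basis direction; summing over the basis gives the inner products.\<close>

lemma has_weak_deriv_inner:
  assumes "u \<in> L2" "v \<in> L2" "has_weak_deriv u v" "vtest \<Phi>"
  shows "abs_l2 (vderiv \<Phi>) \<bullet> abs_l2 u = - (abs_l2 \<Phi> \<bullet> abs_l2 v)"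
proof -
  let ?\<phi> = "\<lambda>b x. \<Phi> x \<bullet> b"
  have t: "test_function (?\<phi> b)" if "b \<in> Basis" for b
    using assms that by (simp add: vtest_def)
  have i: "integrable lborel (\<lambda>x. ?\<phi> b x *\<^sub>R v x)"
    and i': "integrable lborel (\<lambda>x. deriv (?\<phi> b) x *\<^sub>R u x)" if "b \<in> Basis" for b
    using test_function_L2[OF t[OF that]] assms by (auto intro!: L2_integrable_scaleR)
  have eq: "\<Phi> x \<bullet> v x = (\<Sum>b\<in>Basis. (?\<phi> b x *\<^sub>R v x) \<bullet> b)"
    and eq': "vderiv \<Phi> x \<bullet> u x = (\<Sum>b\<in>Basis. (deriv (?\<phi> b) x *\<^sub>R u x) \<bullet> b)" for x
    by (subst euclidean_inner; simp add: vderiv_inner)+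
  have "(LINT x|lborel. vderiv \<Phi> x \<bullet> u x) = (\<Sum>b\<in>Basis. (LINT x|lborel. deriv (?\<phi> b) x *\<^sub>R u x) \<bullet> b)"
    unfolding eq' by (subst Bochner_Integration.integral_sum)
      (auto intro!: integrable_inner_left i' sum.cong simp del: inner_scaleR_left simp: integral_inner_left i')
  also have "\<dots> = (\<Sum>b\<in>Basis. - (LINT x|lborel. ?\<phi> b x *\<^sub>R v x) \<bullet> b)"
    using assms(3) t unfolding has_weak_deriv_def by (intro sum.cong) auto
  also have "\<dots> = - (\<Sum>b\<in>Basis. (LINT x|lborel. ?\<phi> b x *\<^sub>R v x) \<bullet> b)"
    by (simp add: sum_negf)
  also have "\<dots> = - (LINT x|lborel. \<Phi> x \<bullet> v x)"
    unfolding eq by (subst Bochner_Integration.integral_sum)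
      (auto intro!: integrable_inner_left i sum.cong simp del: inner_scaleR_left simp: integral_inner_left i)
  finally show ?thesis
    using assms vtest_l2_deriv[OF assms(4)] by (simp add: abs_l2_inner)
qed

text \<open>A three-epsilon argument: translation is isometric, so replacing \<open>w\<close> by a
  nearby test function costs the same before and after the shift, and for test functions the
  translates are even differentiable in h.\<close>

lemma shift_tendsto:
  fixes w :: "'e::euclidean_space l2"
  shows "((\<lambda>h. shift h w) \<longlongrightarrow> w) (at 0)"
proof (rule tendstoI)
  fix \<epsilon> :: real assume "\<epsilon> > 0"
  then obtain \<Phi> where \<Phi>: "vtest \<Phi>" "norm (abs_l2 \<Phi> - w) < \<epsilon> / 3"
    using vtest_dense[of "\<epsilon> / 3" w] by auto
  have "((\<lambda>h. shift h (abs_l2 \<Phi>)) \<longlongrightarrow> shift 0 (abs_l2 \<Phi>)) (at 0)"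
    using has_vector_derivative_continuous[OF l2_deriv_has_vector_derivative[OF vtest_l2_deriv(3)[OF \<Phi>(1)], of 0]]
    by (simp add: continuous_within)
  then have "\<forall>\<^sub>F h in at 0. dist (shift h (abs_l2 \<Phi>)) (shift 0 (abs_l2 \<Phi>)) < \<epsilon> / 3"
    by (rule tendstoD) (use \<open>\<epsilon> > 0\<close> in simp)
  then show "\<forall>\<^sub>F h in at 0. dist (shift h w) w < \<epsilon>"
  proof eventually_elim
    case (elim h)
    have "shift h w - w = (shift h (abs_l2 \<Phi>) - abs_l2 \<Phi>) + ((abs_l2 \<Phi> - w) - shift h (abs_l2 \<Phi> - w))"
      by (simp add: shift_diff)
    also have "norm \<dots> \<le> norm (shift h (abs_l2 \<Phi>) - abs_l2 \<Phi>)
        + (norm (abs_l2 \<Phi> - w) + norm (shift h (abs_l2 \<Phi> - w)))"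
      by (intro order_trans[OF norm_triangle_ineq] add_left_mono norm_triangle_ineq4)
    also have "\<dots> < \<epsilon>"
      unfolding norm_shift using elim \<Phi>(2) by (simp add: dist_norm)
    finally show ?case by (simp add: dist_norm)
  qed
qed

text \<open>By density the test functions can tend to \<open>w\<close> itself, which turns the bound
  into |w|^2 \<le> c |w|.\<close>

lemma norm_le_by_vtest:
  fixes w :: "'e::euclidean_space l2"
  assumes "\<And>\<Phi>. vtest \<Phi> \<Longrightarrow> w \<bullet> abs_l2 \<Phi> \<le> c * norm (abs_l2 \<Phi>)" and "c \<ge> 0"
  shows "norm w \<le> c"
proof -
  have "\<exists>\<Phi>. vtest \<Phi> \<and> norm (abs_l2 \<Phi> - w) < 1 / real (Suc n)" for n
  proof -
    have "0 < 1 / real (Suc n)" by simp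
    from vtest_dense[OF this, of w] show ?thesis by metis
  qed
  then obtain \<Phi> where \<Phi>: "\<And>n. vtest (\<Phi> n)" "\<And>n. norm (abs_l2 (\<Phi> n) - w) < 1 / real (Suc n)"
    by metis
  have lim: "(\<lambda>n. abs_l2 (\<Phi> n)) \<longlonglongrightarrow> w"
    by (rule LIM_zero_cancel, rule LIMSEQ_norm_0) (rule \<Phi>)
  have "w \<bullet> w \<le> c * norm w"
    by (rule LIMSEQ_le[OF tendsto_inner[OF tendsto_const lim] tendsto_mult[OF tendsto_const tendsto_norm[OF lim]]])
       (use assms \<Phi> in auto)
  then have "norm w * norm w \<le> c * norm w"
    by (simp add: power2_norm_eq_inner[symmetric] power2_eq_square)
  then show ?thesis using \<open>c \<ge> 0\<close> by (cases "norm w = 0") auto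
qed

text \<open>
  For a test function \<open>\<Phi>\<close>, the map \<open>h \<mapsto> \<langle>u, \<Phi>(\<cdot> + h)\<rangle>\<close> has derivative \<open>-\<langle>v, \<Phi>(\<cdot> + h)\<rangle>\<close>, so the mean
  value theorem bounds \<open>\<langle>shift h u - u - h v, \<Phi>\<rangle>\<close> by the modulus of continuity of \<open>h \<mapsto> shift h v\<close>.
\<close>

lemma weak_imp_l2_deriv:
  fixes u v :: "'e::euclidean_space l2"
  assumes weak: "\<And>\<Phi>. vtest \<Phi> \<Longrightarrow> abs_l2 (vderiv \<Phi>) \<bullet> u = - (abs_l2 \<Phi> \<bullet> v)"
  shows "l2_deriv u v"
proof -
  have key: "norm (shift h u - u - h *\<^sub>R v) \<le> \<bar>h\<bar> * \<eta>"
    if \<eta>: "\<eta> \<ge> 0" "\<And>k. \<bar>k\<bar> \<le> \<bar>h\<bar> \<Longrightarrow> norm (shift k v - v) \<le> \<eta>" for h \<eta>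
  proof (rule norm_le_by_vtest)
    fix \<Phi> :: "real \<Rightarrow> 'e" assume \<Phi>: "vtest \<Phi>"
    note L2 = vtest_l2_deriv(1,2)[OF \<Phi>]
    define F where "F k = u \<bullet> shift (- k) (abs_l2 \<Phi>) - k * (v \<bullet> abs_l2 \<Phi>)" for k
    have weak': "shift k (abs_l2 (vderiv \<Phi>)) \<bullet> u = - (shift k (abs_l2 \<Phi>) \<bullet> v)" for k
      using weak[OF vtest_translate(1)[OF \<Phi>], of k]
      by (simp add: vtest_translate(2)[OF \<Phi>] shift_abs L2)
    have D: "(F has_real_derivative ((shift k v - v) \<bullet> abs_l2 \<Phi>)) (at k)" for k
    proof -
      have "((\<lambda>k. shift (- k) (abs_l2 \<Phi>)) has_vector_derivative (- 1) *\<^sub>R shift (- k) (abs_l2 (vderiv \<Phi>))) (at k)"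
        by (rule vector_diff_chain_at[of uminus, unfolded o_def])
           (auto intro!: derivative_eq_intros l2_deriv_has_vector_derivative vtest_l2_deriv \<Phi>)
      from bounded_linear.has_vector_derivative[OF bounded_linear_inner_right[of u] this]
      have "((\<lambda>k. u \<bullet> shift (- k) (abs_l2 \<Phi>)) has_real_derivative
          u \<bullet> ((- 1) *\<^sub>R shift (- k) (abs_l2 (vderiv \<Phi>)))) (at k)"
        by (simp only: has_real_derivative_iff_has_vector_derivative)
      then have "((\<lambda>k. u \<bullet> shift (- k) (abs_l2 \<Phi>)) has_real_derivative shift k v \<bullet> abs_l2 \<Phi>) (at k)"
        using weak'[of "- k"]
        by (simp add: inner_shift_left[of k v] inner_commute[of _ u] inner_commute[of _ v])
      then show ?thesis
        unfolding F_def inner_diff_left by (auto intro!: derivative_eq_intros)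
    qed
    have "norm (F h - F 0) \<le> (\<eta> * norm (abs_l2 \<Phi>)) * norm (h - 0)"
    proof (rule field_differentiable_bound[where S = "{-\<bar>h\<bar>..\<bar>h\<bar>}"])
      fix k assume "k \<in> {-\<bar>h\<bar>..\<bar>h\<bar>}"
      then have "norm (shift k v - v) \<le> \<eta>" by (intro \<eta>) auto
      then show "norm ((shift k v - v) \<bullet> abs_l2 \<Phi>) \<le> \<eta> * norm (abs_l2 \<Phi>)"
        by (auto intro!: order_trans[OF Cauchy_Schwarz_ineq2] mult_right_mono)
    qed (auto intro: has_field_derivative_at_within D)
    moreover have "F h - F 0 = (shift h u - u - h *\<^sub>R v) \<bullet> abs_l2 \<Phi>"
      by (simp add: F_def inner_diff_left inner_shift_left)
    ultimately show "(shift h u - u - h *\<^sub>R v) \<bullet> abs_l2 \<Phi> \<le> \<bar>h\<bar> * \<eta> * norm (abs_l2 \<Phi>)"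
      by (simp add: algebra_simps abs_le_iff)
  qed (use \<eta> in simp)
  show ?thesis
    unfolding l2_deriv_def
  proof (rule tendstoI)
    fix \<epsilon> :: real assume "\<epsilon> > 0"
    then have "\<forall>\<^sub>F h in at 0. dist (shift h v) v < \<epsilon> / 2"
      by (intro tendstoD[OF shift_tendsto]) simp
    then obtain d where d: "d > 0" "\<And>h. h \<noteq> 0 \<Longrightarrow> \<bar>h\<bar> < d \<Longrightarrow> dist (shift h v) v < \<epsilon> / 2"
      by (auto simp: eventually_at)
    show "\<forall>\<^sub>F h in at 0. dist ((1 / h) *\<^sub>R (shift h u - u)) v < \<epsilon>"
      unfolding eventually_at
    proof (intro exI[of _ d] conjI ballI impI)
      fix h :: real assume h: "h \<noteq> 0 \<and> dist h 0 < d"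
      have "norm (shift h u - u - h *\<^sub>R v) \<le> \<bar>h\<bar> * (\<epsilon> / 2)"
      proof (rule key)
        fix k assume "\<bar>k\<bar> \<le> \<bar>h\<bar>"
        then show "norm (shift k v - v) \<le> \<epsilon> / 2"
          using d(2)[of k] h \<open>\<epsilon> > 0\<close> by (cases "k = 0") (auto simp: dist_norm)
      qed (use \<open>\<epsilon> > 0\<close> in simp)
      moreover have "(1 / h) *\<^sub>R (shift h u - u) - v = (1 / h) *\<^sub>R (shift h u - u - h *\<^sub>R v)"
        using h by (simp add: scaleR_diff_right)
      then have "norm ((1 / h) *\<^sub>R (shift h u - u) - v) = norm (shift h u - u - h *\<^sub>R v) / \<bar>h\<bar>"
        by simp
      ultimately have "norm ((1 / h) *\<^sub>R (shift h u - u) - v) \<le> \<epsilon> / 2"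
        using h divide_right_mono[of "norm (shift h u - u - h *\<^sub>R v)" "\<bar>h\<bar> * (\<epsilon> / 2)" "\<bar>h\<bar>"] by simp
      then show "dist ((1 / h) *\<^sub>R (shift h u - u)) v < \<epsilon>"
        using \<open>\<epsilon> > 0\<close> by (simp add: dist_norm)
    qed (rule d)
  qed
qed

lemma has_weak_deriv_l2_deriv:
  "u \<in> L2 \<Longrightarrow> v \<in> L2 \<Longrightarrow> has_weak_deriv u v \<Longrightarrow> l2_deriv (abs_l2 u) (abs_l2 v)"
  by (rule weak_imp_l2_deriv) (rule has_weak_deriv_inner)

section \<open>Functions in H1 as elements of the domain of the generator\<close>

lemma H1_L2: "u \<in> H1 \<Longrightarrow> u \<in> L2"
  by (simp add: H1_def)

lemma weak_deriv_H1:
  assumes "u \<in> H1"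
  shows "weak_deriv u \<in> L2" "has_weak_deriv u (weak_deriv u)"
  using someI_ex[of "\<lambda>v. v \<in> L2 \<and> has_weak_deriv u v"] assms
  by (auto simp: weak_deriv_def H1_def)

lemma H1_l2_deriv: "u \<in> H1 \<Longrightarrow> l2_deriv (abs_l2 u) (abs_l2 (weak_deriv u))"
  by (intro has_weak_deriv_l2_deriv H1_L2 weak_deriv_H1)

lemma H1_diff:
  assumes "u \<in> H1" "w \<in> H1"
  shows "(\<lambda>x. u x - w x) \<in> H1"
proof -
  have "has_weak_deriv (\<lambda>x. u x - w x) (\<lambda>x. weak_deriv u x - weak_deriv w x)"
    unfolding has_weak_deriv_def
  proof (intro allI impI)
    fix \<phi> :: "real \<Rightarrow> real" assume t: "test_function \<phi>"
    note i = L2_integrable_scaleR[OF test_function_L2(1)[OF t]] L2_integrable_scaleR[OF test_function_L2(2)[OF t]]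
    show "(LINT x|lborel. deriv \<phi> x *\<^sub>R (u x - w x)) = - (LINT x|lborel. \<phi> x *\<^sub>R (weak_deriv u x - weak_deriv w x))"
      using t weak_deriv_H1(2)[OF assms(1)] weak_deriv_H1(2)[OF assms(2)]
      by (simp add: scaleR_diff_right i H1_L2 weak_deriv_H1(1) assms has_weak_deriv_def)
  qed
  moreover have "(\<lambda>x. weak_deriv u x - weak_deriv w x) \<in> L2" "(\<lambda>x. u x - w x) \<in> L2"
    using assms by (simp_all add: L2_diff H1_L2 weak_deriv_H1(1))
  ultimately show ?thesis
    unfolding H1_def by blast
qed

text \<open>Since \<open>weak_deriv\<close> is a choice, it need not respect differences pointwise;
  uniqueness of the limit in \<open>l2_deriv\<close> forces the classes to agree.\<close>

lemma H1_norm_diff: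
  assumes "u \<in> H1" "w \<in> H1"
  shows "H1_norm (\<lambda>x. u x - w x) =
    sqrt ((norm (abs_l2 u - abs_l2 w))\<^sup>2 + (norm (abs_l2 (weak_deriv u) - abs_l2 (weak_deriv w)))\<^sup>2)"
proof -
  let ?d = "\<lambda>x. u x - w x"
  have d: "?d \<in> H1" using assms by (rule H1_diff)
  have 1: "abs_l2 ?d = abs_l2 u - abs_l2 w"
    using assms by (simp add: abs_l2_diff H1_L2)
  have "abs_l2 (weak_deriv ?d) = abs_l2 (weak_deriv u) - abs_l2 (weak_deriv w)"
    using H1_l2_deriv[OF d] l2_deriv_diff[OF H1_l2_deriv[OF assms(1)] H1_l2_deriv[OF assms(2)]]
    unfolding 1 by (rule l2_deriv_unique)
  then show ?thesis
    unfolding H1_norm_def norm_abs_l2[OF H1_L2[OF d], symmetric]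
      norm_abs_l2[OF weak_deriv_H1(1)[OF d], symmetric] 1 by simp
qed

section \<open>Energy identities\<close>

text \<open>Stated for classes, with the space and time derivatives as parameters, so that it can be
  interpreted again for the difference quotients in x of a given solution.\<close>

locale l2_solution =
  fixes A B :: "real ^ 'n ^ 'n" and U P V :: "real \<Rightarrow> (real ^ 'n) l2"
  assumes symA: "transpose A = A" and symB: "transpose B = B"
    and l2_deriv: "\<And>t. t \<ge> 0 \<Longrightarrow> l2_deriv (U t) (P t)"
    and cont: "continuous_on {0..} P"
    and quotient: "\<And>t. t \<ge> 0 \<Longrightarrow> ((\<lambda>s. (1 / (s - t)) *\<^sub>R (U s - U t)) \<longlongrightarrow> V t) (at t within {0..})"
    and evolution: "\<And>t. t \<ge> 0 \<Longrightarrow> V t = - mat_l2 A (P t) - mat_l2 B (U t)"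
begin

lemma U_derivative: "t \<ge> 0 \<Longrightarrow> (U has_vector_derivative V t) (at t within {0..})"
  by (intro has_vector_derivative_quotient quotient)

lemma U_continuous: "continuous_on {0..} U"
  unfolding continuous_on_eq_continuous_within
proof
  fix t :: real assume "t \<in> {0..}"
  then show "continuous (at t within {0..}) U"
    by (intro has_vector_derivative_continuous[OF U_derivative]) simp
qed

text \<open>The transport term does no work: a symmetric matrix composed with the skew-adjoint
  generator gives a number equal to its own negative.\<close>

lemma inner_A_P: "t \<ge> 0 \<Longrightarrow> U t \<bullet> mat_l2 A (P t) = 0"
  using l2_deriv_inner_by_parts[OF l2_deriv l2_deriv_mat[OF l2_deriv, of t A], of t] inner_mat_l2[of A "P t" "U t"]
  by (simp add: symA inner_commute)

lemma energy_derivative: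
  assumes "t \<ge> 0"
  shows "((\<lambda>t. U t \<bullet> U t) has_real_derivative - 2 * (U t \<bullet> mat_l2 B (U t))) (at t within {0..})"
proof -
  have "((\<lambda>t. U t \<bullet> U t) has_derivative (\<lambda>h. U t \<bullet> (h *\<^sub>R V t) + (h *\<^sub>R V t) \<bullet> U t)) (at t within {0..})"
    using U_derivative[OF assms] unfolding has_vector_derivative_def by (intro has_derivative_inner)
  then have "((\<lambda>t. U t \<bullet> U t) has_real_derivative 2 * (U t \<bullet> V t)) (at t within {0..})"
    unfolding has_field_derivative_def by (rule has_derivative_eq_rhs) (auto simp: inner_commute)
  then show ?thesis
    using inner_A_P[OF assms] by (simp add: evolution assms inner_diff_right)
qed

lemma B_form_derivative:
  assumes "t \<ge> 0"
  shows "((\<lambda>t. U t \<bullet> mat_l2 B (U t)) has_real_derivative 2 * (mat_l2 B (U t) \<bullet> V t)) (at t within {0..})"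
proof -
  have "((\<lambda>t. mat_l2 B (U t)) has_vector_derivative mat_l2 B (V t)) (at t within {0..})"
    by (rule bounded_linear.has_vector_derivative[OF bounded_linear_mat_l2 U_derivative[OF assms]])
  then have "((\<lambda>t. U t \<bullet> mat_l2 B (U t)) has_derivative
      (\<lambda>h. U t \<bullet> (h *\<^sub>R mat_l2 B (V t)) + (h *\<^sub>R V t) \<bullet> mat_l2 B (U t))) (at t within {0..})"
    using U_derivative[OF assms] unfolding has_vector_derivative_def by (intro has_derivative_inner)
  moreover have "U t \<bullet> mat_l2 B (V t) = mat_l2 B (U t) \<bullet> V t"
    by (simp add: inner_mat_l2 symB)
  ultimately show ?thesis
    unfolding has_field_derivative_def
    by - (erule has_derivative_eq_rhs, auto simp: inner_commute algebra_simps)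
qed

text \<open>
  The form only pairs \<open>U\<close> with \<open>P = \<partial>\<^sub>x U\<close>, so integrating by parts moves the time increment of \<open>P\<close>
  onto \<open>U\<close> and no time derivative of \<open>P\<close> is needed.
\<close>

lemma cross_term_derivative:
  assumes "t \<ge> 0"
  shows "((\<lambda>t. mat_l2 M (U t) \<bullet> mat_l2 N (P t)) has_real_derivative
    mat_l2 M (V t) \<bullet> mat_l2 N (P t) - mat_l2 M (P t) \<bullet> mat_l2 N (V t)) (at t within {0..})"
proof -
  let ?q = "\<lambda>s. (1 / (s - t)) *\<^sub>R (U s - U t)"
  have P: "(P \<longlongrightarrow> P t) (at t within {0..})"
    using cont assms by (auto simp: continuous_on_def)
  have "((\<lambda>s. mat_l2 M (?q s) \<bullet> mat_l2 N (P s) - mat_l2 M (P t) \<bullet> mat_l2 N (?q s)) \<longlongrightarrow>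
      mat_l2 M (V t) \<bullet> mat_l2 N (P t) - mat_l2 M (P t) \<bullet> mat_l2 N (V t)) (at t within {0..})"
    by (intro tendsto_diff tendsto_inner tendsto_const bounded_linear.tendsto[OF bounded_linear_mat_l2]
        quotient[OF assms] P)
  moreover have "\<forall>\<^sub>F s in at t within {0..}.
      mat_l2 M (?q s) \<bullet> mat_l2 N (P s) - mat_l2 M (P t) \<bullet> mat_l2 N (?q s)
      = (mat_l2 M (U s) \<bullet> mat_l2 N (P s) - mat_l2 M (U t) \<bullet> mat_l2 N (P t)) / (s - t)"
    unfolding eventually_at_filter
  proof (rule always_eventually, intro allI impI)
    fix s :: real assume s: "s \<noteq> t" "s \<in> {0..}"
    have "mat_l2 M (P t) \<bullet> mat_l2 N (U s - U t) = - (mat_l2 M (U t) \<bullet> mat_l2 N (P s - P t))"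
      using s assms by (intro l2_deriv_inner_by_parts l2_deriv_mat l2_deriv_diff l2_deriv) auto
    then have "mat_l2 M (U s - U t) \<bullet> mat_l2 N (P s) - mat_l2 M (P t) \<bullet> mat_l2 N (U s - U t)
        = mat_l2 M (U s) \<bullet> mat_l2 N (P s) - mat_l2 M (U t) \<bullet> mat_l2 N (P t)"
      by (simp add: mat_l2_diff inner_diff_left inner_diff_right)
    then show "mat_l2 M (?q s) \<bullet> mat_l2 N (P s) - mat_l2 M (P t) \<bullet> mat_l2 N (?q s)
        = (mat_l2 M (U s) \<bullet> mat_l2 N (P s) - mat_l2 M (U t) \<bullet> mat_l2 N (P t)) / (s - t)"
      unfolding mat_l2_scaleR inner_scaleR_left inner_scaleR_right right_diff_distrib[symmetric] by simp
  qed
  ultimately show ?thesis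
    unfolding has_field_derivative_iff by (rule Lim_transform_eventually)
qed

text \<open>Constant coefficients commute with translations. The quotients, unlike \<open>P\<close>,
  inherit a time derivative in L2 from \<open>U\<close>, so the energy identity applies to
  them.\<close>

lemma shift_quotient_solution:
  "l2_solution A B (\<lambda>t. (1 / h) *\<^sub>R (shift h (U t) - U t)) (\<lambda>t. (1 / h) *\<^sub>R (shift h (P t) - P t))
    (\<lambda>t. (1 / h) *\<^sub>R (shift h (V t) - V t))"
proof
  show "continuous_on {0..} (\<lambda>t. (1 / h) *\<^sub>R (shift h (P t) - P t))"
    by (intro continuous_intros cont bounded_linear.continuous_on[OF bounded_linear_shift])
  fix t :: real assume t: "t \<ge> 0"
  show "l2_deriv ((1 / h) *\<^sub>R (shift h (U t) - U t)) ((1 / h) *\<^sub>R (shift h (P t) - P t))"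
    by (intro l2_deriv_scaleR l2_deriv_diff l2_deriv_shift l2_deriv t)
  let ?q = "\<lambda>s. (1 / (s - t)) *\<^sub>R (U s - U t)"
  have "((\<lambda>s. (1 / h) *\<^sub>R (shift h (?q s) - ?q s)) \<longlongrightarrow> (1 / h) *\<^sub>R (shift h (V t) - V t)) (at t within {0..})"
    by (intro tendsto_intros bounded_linear.tendsto[OF bounded_linear_shift] quotient t)
  moreover have "(1 / h) *\<^sub>R (shift h (?q s) - ?q s)
      = (1 / (s - t)) *\<^sub>R ((1 / h) *\<^sub>R (shift h (U s) - U s) - (1 / h) *\<^sub>R (shift h (U t) - U t))" for s
    by (simp add: shift_scaleR shift_diff scaleR_right_diff_distrib[symmetric] scaleR_left_commute[of "1 / h"])
       (simp add: algebra_simps)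
  ultimately show "((\<lambda>s. (1 / (s - t)) *\<^sub>R ((1 / h) *\<^sub>R (shift h (U s) - U s) - (1 / h) *\<^sub>R (shift h (U t) - U t)))
      \<longlongrightarrow> (1 / h) *\<^sub>R (shift h (V t) - V t)) (at t within {0..})"
    by simp
  show "(1 / h) *\<^sub>R (shift h (V t) - V t) =
      - mat_l2 A ((1 / h) *\<^sub>R (shift h (P t) - P t)) - mat_l2 B ((1 / h) *\<^sub>R (shift h (U t) - U t))"
    by (simp add: evolution t mat_l2_scaleR mat_l2_diff shift_diff shift_mat_l2
        linear_neg[OF linear_shift] algebra_simps)
qed (rule symA symB)+

text \<open>The energy identity of the difference quotients is integrated in time before the step
  tends to 0. \<open>norm_shift_diff_le\<close> bounds each quotient by |P(t)|, which is the
  domination for exchanging limit and integral.\<close>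

lemma energy_P_integral:
  assumes T: "T \<ge> 0"
  shows "P T \<bullet> P T = P 0 \<bullet> P 0 - 2 * integral {0..T} (\<lambda>t. P t \<bullet> mat_l2 B (P t))"
proof -
  define h where "h n = 1 / real (Suc n)" for n
  define W where "W n t = (1 / h n) *\<^sub>R (shift (h n) (U t) - U t)" for n t
  have h: "filterlim h (at 0) sequentially"
    unfolding h_def filterlim_at using LIMSEQ_inverse_real_of_nat by (simp add: inverse_eq_divide)
  have lim: "(\<lambda>n. W n t) \<longlonglongrightarrow> P t" if "t \<ge> 0" for t
    using filterlim_compose[OF l2_deriv[OF that, unfolded l2_deriv_def] h] by (simp add: W_def)
  have W_le: "norm (W n t) \<le> norm (P t)" if "t \<ge> 0" for n t
  proof -
    have "h n > 0" by (simp add: h_def)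
    then show ?thesis
      using norm_shift_diff_le[OF l2_deriv[OF that], of "h n"] by (simp add: W_def pos_divide_le_eq mult.commute)
  qed
  obtain K where K: "\<And>x. norm (mat_l2 B x) \<le> norm x * K"
    using bounded_linear.bounded[OF bounded_linear_mat_l2[of B]] by auto
  have int: "((\<lambda>t. - 2 * (W n t \<bullet> mat_l2 B (W n t))) has_integral (W n T \<bullet> W n T - W n 0 \<bullet> W n 0)) {0..T}" for n
  proof (rule fundamental_theorem_of_calculus[OF T])
    interpret W: l2_solution A B "W n" "\<lambda>t. (1 / h n) *\<^sub>R (shift (h n) (P t) - P t)"
      "\<lambda>t. (1 / h n) *\<^sub>R (shift (h n) (V t) - V t)"
      unfolding W_def by (rule shift_quotient_solution)
    fix t assume "t \<in> {0..T}"
    then show "((\<lambda>t. W n t \<bullet> W n t) has_vector_derivative - 2 * (W n t \<bullet> mat_l2 B (W n t))) (at t within {0..T})"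
      using has_field_derivative_subset[OF W.energy_derivative[of t], of "{0..T}"]
      by (auto simp: has_real_derivative_iff_has_vector_derivative)
  qed
  have cP: "continuous_on {0..T} P"
    using cont by (rule continuous_on_subset) auto
  have "(\<lambda>n. integral {0..T} (\<lambda>t. - 2 * (W n t \<bullet> mat_l2 B (W n t))))
      \<longlonglongrightarrow> integral {0..T} (\<lambda>t. - 2 * (P t \<bullet> mat_l2 B (P t)))"
  proof (rule dominated_convergence(2))
    show "(\<lambda>t. - 2 * (W n t \<bullet> mat_l2 B (W n t))) integrable_on {0..T}" for n
      using int by blast
    show "(\<lambda>t. 2 * (norm (P t) * norm (P t)) * \<bar>K\<bar>) integrable_on {0..T}"
      by (intro integrable_continuous_real continuous_intros cP)
    show "norm (- 2 * (W n t \<bullet> mat_l2 B (W n t))) \<le> 2 * (norm (P t) * norm (P t)) * \<bar>K\<bar>" if "t \<in> {0..T}" for n t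
    proof -
      have "\<bar>W n t \<bullet> mat_l2 B (W n t)\<bar> \<le> norm (W n t) * (norm (W n t) * \<bar>K\<bar>)"
        by (rule order_trans[OF Cauchy_Schwarz_ineq2])
           (intro mult_left_mono order_trans[OF K] abs_ge_self norm_ge_zero)
      also have "\<dots> \<le> norm (P t) * (norm (P t) * \<bar>K\<bar>)"
        using W_le[of t n] that by (intro mult_mono) auto
      finally show ?thesis by (simp add: mult.assoc)
    qed
    show "(\<lambda>n. - 2 * (W n t \<bullet> mat_l2 B (W n t))) \<longlonglongrightarrow> - 2 * (P t \<bullet> mat_l2 B (P t))" if "t \<in> {0..T}" for t
      using that by (intro tendsto_intros lim bounded_linear.tendsto[OF bounded_linear_mat_l2]) auto
  qed
  then have "(\<lambda>n. W n T \<bullet> W n T - W n 0 \<bullet> W n 0) \<longlonglongrightarrow> - 2 * integral {0..T} (\<lambda>t. P t \<bullet> mat_l2 B (P t))"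
    unfolding integral_unique[OF int] by (simp only: integral_mult_right)
  moreover have "(\<lambda>n. W n T \<bullet> W n T - W n 0 \<bullet> W n 0) \<longlonglongrightarrow> P T \<bullet> P T - P 0 \<bullet> P 0"
    using T by (intro tendsto_intros lim) auto
  ultimately have "P T \<bullet> P T - P 0 \<bullet> P 0 = - 2 * integral {0..T} (\<lambda>t. P t \<bullet> mat_l2 B (P t))"
    by (rule LIMSEQ_unique[rotated])
  then show ?thesis by simp
qed

text \<open>The integrand is continuous, so the integral identity can be differentiated back.
  Interior times are enough, because the monotonicity arguments use derivatives on an open interval
  and continuity up to its ends.\<close>

lemma energy_P_derivative:
  assumes t: "t > 0"
  shows "((\<lambda>t. P t \<bullet> P t) has_real_derivative - 2 * (P t \<bullet> mat_l2 B (P t))) (at t)"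
proof -
  \<comment> \<open>The upper end t + 1 makes t an interior point, so that the derivative within the
    interval is a two-sided one.\<close>
  have "continuous_on {0..t + 1} (\<lambda>t. P t \<bullet> mat_l2 B (P t))"
    by (intro continuous_intros continuous_on_subset[OF cont]
        bounded_linear.continuous_on[OF bounded_linear_mat_l2]) auto
  from integral_has_real_derivative[OF this, of t]
  have "((\<lambda>x. integral {0..x} (\<lambda>t. P t \<bullet> mat_l2 B (P t))) has_real_derivative P t \<bullet> mat_l2 B (P t))
      (at t within {0..t + 1})"
    using t by auto
  then have "((\<lambda>x. integral {0..x} (\<lambda>t. P t \<bullet> mat_l2 B (P t))) has_real_derivative P t \<bullet> mat_l2 B (P t)) (at t)"
    using t by (simp add: at_within_Icc_at)
  then have "((\<lambda>x. P 0 \<bullet> P 0 - 2 * integral {0..x} (\<lambda>t. P t \<bullet> mat_l2 B (P t)))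
      has_real_derivative - 2 * (P t \<bullet> mat_l2 B (P t))) (at t)"
    by (auto intro!: derivative_eq_intros)
  then show ?thesis
    by (rule has_field_derivative_transform_within_open[where S = "{0<..}"])
       (use t in \<open>auto simp flip: energy_P_integral\<close>)
qed

lemma derivative_at:
  assumes "t > 0" "(f has_real_derivative D) (at t within {0..})"
  shows "(f has_real_derivative D) (at t)"
proof -
  have "at t within {0..} = at t"
    using assms(1) by (intro at_within_interior) simp
  then show ?thesis using assms(2) by simp
qed

end

section \<open>Hypocoercivity\<close>

text \<open>The matrix B A^k, which for symmetric matrices is the transpose of the Kalman block A^k
  B. Multiplying on the right lets the transport term turn row k into row k + 1, which is the source
  of the square gained in \<open>cross_rate\<close>.\<close>

primrec kalman_row :: "real ^ 'n ^ 'n \<Rightarrow> real ^ 'n ^ 'n \<Rightarrow> nat \<Rightarrow> real ^ 'n ^ 'n" where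
  "kalman_row A B 0 = B"
| "kalman_row A B (Suc k) = kalman_row A B k ** A"

text \<open>
  The time derivative of \<open>\<langle>B A\<^sup>k u, B A\<^bsup>k+1\<^esup> p\<rangle>\<close> along the flow, where \<open>p = \<partial>\<^sub>x u\<close>.
\<close>

definition cross_rate ::
    "real ^ 'n ^ 'n \<Rightarrow> real ^ 'n ^ 'n \<Rightarrow> nat \<Rightarrow> (real ^ 'n) l2 \<Rightarrow> (real ^ 'n) l2 \<Rightarrow> real" where
  "cross_rate A B k u p =
    (let v = - mat_l2 A p - mat_l2 B u; M = kalman_row A B k; N = kalman_row A B (Suc k)
     in mat_l2 M v \<bullet> mat_l2 N p - mat_l2 M p \<bullet> mat_l2 N v)"

lemma mat_l2_norm_bound:
  obtains K where "K \<ge> 0" "\<And>u. norm (mat_l2 M u) \<le> K * norm u"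
  using bounded_linear.nonneg_bounded[OF bounded_linear_mat_l2[of M]] by (metis mult.commute)

text \<open>Young's inequality with a weight, by completing the square.\<close>

lemma mult_le_weighted_squares:
  fixes x y :: real
  assumes "\<eta> > 0"
  shows "x * y \<le> \<eta> * y\<^sup>2 + x\<^sup>2 / (4 * \<eta>)"
proof -
  have "0 \<le> (2 * \<eta> * y - x)\<^sup>2 / (4 * \<eta>)"
    using assms by simp
  also have "\<dots> = \<eta> * y\<^sup>2 + x\<^sup>2 / (4 * \<eta>) - x * y"
    using assms by (simp add: power2_eq_square field_simps)
  finally show ?thesis by simp
qed

text \<open>Applying row k to -A p gives minus row k + 1, which yields the negative square. Each of
  the three remaining terms contains B u or row k of p, so Young's inequality leaves only an
  arbitrarily small multiple of |p|^2.\<close>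

lemma cross_rate_le:
  assumes "\<eta> > 0"
  obtains K where "K \<ge> 0" "\<And>u p. cross_rate A B k u p \<le> - (norm (mat_l2 (kalman_row A B (Suc k)) p))\<^sup>2
    + \<eta> * (norm p)\<^sup>2 + K * ((norm (mat_l2 (kalman_row A B k) p))\<^sup>2 + (norm (mat_l2 B u))\<^sup>2)"
proof -
  let ?M = "mat_l2 (kalman_row A B k)" and ?N = "mat_l2 (kalman_row A B (Suc k))"
  obtain C where C: "C \<ge> 0" "\<And>u. norm (?M u) \<le> C * norm u"
    using mat_l2_norm_bound by blast
  obtain C' where C': "C' \<ge> 0" "\<And>u. norm (?N u) \<le> C' * norm u"
    using mat_l2_norm_bound by blast
  obtain C'' where C'': "C'' \<ge> 0" "\<And>u. norm (?N (mat_l2 A u)) \<le> C'' * norm u"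
    unfolding mat_l2_mult using mat_l2_norm_bound by blast
  show ?thesis
  proof (rule that)
    \<comment> \<open>Two error terms involve |p| and receive \<eta>/2 each. \<open>?K\<close> adds
      up the coefficients left in front of the squares of \<open>?M p\<close> and B u; the 1 comes
      from the product of these two.\<close>
    let ?K = "C''\<^sup>2 / (2 * \<eta>) + (C * C')\<^sup>2 / (2 * \<eta>) + C'\<^sup>2 + 1"
    show "?K \<ge> 0" using assms by simp
    fix u p
    define s b a where "s = norm p" and "b = norm (mat_l2 B u)" and "a = norm (?M p)"
    have sba: "s \<ge> 0" "b \<ge> 0" "a \<ge> 0" by (auto simp: s_def b_def a_def)
    have "cross_rate A B k u p =
        - (?N p \<bullet> ?N p) - ?M (mat_l2 B u) \<bullet> ?N p + ?M p \<bullet> ?N (mat_l2 A p) + ?M p \<bullet> ?N (mat_l2 B u)"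
      by (simp add: cross_rate_def Let_def mat_l2_diff linear_neg[OF linear_mat_l2] mat_l2_mult[symmetric]
          inner_diff_left inner_diff_right)
    moreover have "?N p \<bullet> ?N p = (norm (?N p))\<^sup>2"
      by (simp add: power2_norm_eq_inner)
    moreover have "- (?M (mat_l2 B u) \<bullet> ?N p) \<le> (\<eta> / 2) * s\<^sup>2 + (C * C')\<^sup>2 / (2 * \<eta>) * b\<^sup>2"
    proof -
      have "- (?M (mat_l2 B u) \<bullet> ?N p) \<le> norm (?M (mat_l2 B u)) * norm (?N p)"
        using Cauchy_Schwarz_ineq2[of "?M (mat_l2 B u)" "?N p"] by linarith
      also have "\<dots> \<le> (C * b) * (C' * s)"
        unfolding b_def s_def using C C' by (intro mult_mono) auto
      also have "\<dots> = (C * C' * b) * s" by simp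
      also have "\<dots> \<le> (\<eta> / 2) * s\<^sup>2 + (C * C' * b)\<^sup>2 / (4 * (\<eta> / 2))"
        using assms by (intro mult_le_weighted_squares) simp
      finally show ?thesis by (simp add: power_mult_distrib)
    qed
    moreover have "?M p \<bullet> ?N (mat_l2 A p) \<le> (\<eta> / 2) * s\<^sup>2 + C''\<^sup>2 / (2 * \<eta>) * a\<^sup>2"
    proof -
      have "?M p \<bullet> ?N (mat_l2 A p) \<le> norm (?M p) * norm (?N (mat_l2 A p))"
        by (rule norm_cauchy_schwarz)
      also have "\<dots> \<le> a * (C'' * s)"
        unfolding a_def s_def using C'' by (intro mult_mono) auto
      also have "\<dots> = (C'' * a) * s" by simp
      also have "\<dots> \<le> (\<eta> / 2) * s\<^sup>2 + (C'' * a)\<^sup>2 / (4 * (\<eta> / 2))"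
        using assms by (intro mult_le_weighted_squares) simp
      finally show ?thesis by (simp add: power_mult_distrib)
    qed
    moreover have "?M p \<bullet> ?N (mat_l2 B u) \<le> 1 * a\<^sup>2 + C'\<^sup>2 * b\<^sup>2"
    proof -
      have "?M p \<bullet> ?N (mat_l2 B u) \<le> norm (?M p) * norm (?N (mat_l2 B u))"
        by (rule norm_cauchy_schwarz)
      also have "\<dots> \<le> a * (C' * b)"
        unfolding a_def b_def using C' by (intro mult_mono) auto
      also have "\<dots> \<le> 2 * a * (C' * b)"
        using sba C' by simp
      also have "\<dots> \<le> a\<^sup>2 + (C' * b)\<^sup>2"
        by (rule sum_squares_bound)
      finally show ?thesis by (simp add: power_mult_distrib)
    qed
    moreover have "(C * C')\<^sup>2 / (2 * \<eta>) * b\<^sup>2 + C'\<^sup>2 * b\<^sup>2 \<le> ?K * b\<^sup>2" "C''\<^sup>2 / (2 * \<eta>) * a\<^sup>2 + 1 * a\<^sup>2 \<le> ?K * a\<^sup>2"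
      unfolding distrib_right[symmetric] using assms by (intro mult_right_mono; simp)+
    ultimately have "cross_rate A B k u p \<le> - (norm (?N p))\<^sup>2 + \<eta> * s\<^sup>2 + (?K * a\<^sup>2 + ?K * b\<^sup>2)"
      by linarith
    then show "cross_rate A B k u p \<le> - (norm (?N p))\<^sup>2 + \<eta> * (norm p)\<^sup>2
        + ?K * ((norm (?M p))\<^sup>2 + (norm (mat_l2 B u))\<^sup>2)"
      unfolding a_def b_def s_def distrib_left .
  qed
qed

text \<open>
  The weights are chosen recursively: the error \<open>\<parallel>B A\<^sup>k p\<parallel>\<^sup>2\<close> of the \<open>k\<close>-th cross term is absorbed by the
  gain of the previous ones.
\<close>

lemma cross_rate_chain:
  assumes "\<eta> > 0"
  shows "\<exists>w K. K \<ge> 0 \<and> (\<forall>u p. (\<Sum>k\<le>m. (norm (mat_l2 (kalman_row A B k) p))\<^sup>2)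
    + (\<Sum>k<m. w k * cross_rate A B k u p) \<le> \<eta> * (norm p)\<^sup>2 + K * ((norm (mat_l2 B p))\<^sup>2 + (norm (mat_l2 B u))\<^sup>2))"
  using assms
proof (induction m arbitrary: \<eta>)
  case 0
  then show ?case by (intro exI[of _ "\<lambda>_. 0"] exI[of _ 1]) simp
next
  case (Suc m)
  obtain C where C: "C \<ge> 0" "\<And>u p. cross_rate A B m u p \<le> - (norm (mat_l2 (kalman_row A B (Suc m)) p))\<^sup>2
      + (\<eta> / 2) * (norm p)\<^sup>2 + C * ((norm (mat_l2 (kalman_row A B m) p))\<^sup>2 + (norm (mat_l2 B u))\<^sup>2)"
    using cross_rate_le[of "\<eta> / 2" A B m] Suc.prems by auto
  \<comment> \<open>The old inequality will be multiplied by 1 + C, so it is requested with \<eta> /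
    (2 (1 + C)); with the \<eta>/2 of the new term the total is \<eta>.\<close>
  obtain w K where K: "K \<ge> 0" and IH: "\<And>u p. (\<Sum>k\<le>m. (norm (mat_l2 (kalman_row A B k) p))\<^sup>2)
      + (\<Sum>k<m. w k * cross_rate A B k u p)
      \<le> \<eta> / (2 * (1 + C)) * (norm p)\<^sup>2 + K * ((norm (mat_l2 B p))\<^sup>2 + (norm (mat_l2 B u))\<^sup>2)"
    using Suc.IH[of "\<eta> / (2 * (1 + C))"] Suc.prems C(1) by auto
  \<comment> \<open>The factor 1 + C reproduces the old sum of squares and adds C copies of it, one
    of whose terms absorbs the error C |B A^m p|^2 of the new cross term.\<close>
  define w' where "w' k = (if k < m then (1 + C) * w k else 1)" for k
  show ?case
  proof (intro exI[of _ w'] exI[of _ "(1 + C) * K + C"] conjI allI)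
    show "(1 + C) * K + C \<ge> 0" using C K by simp
    fix u p
    define a where "a k = (norm (mat_l2 (kalman_row A B k) p))\<^sup>2" for k
    define S b a0 X where "S = (norm p)\<^sup>2" and "b = (norm (mat_l2 B u))\<^sup>2" and "a0 = (norm (mat_l2 B p))\<^sup>2"
      and "X = (\<Sum>k<m. w k * cross_rate A B k u p)"
    have nonneg: "a k \<ge> 0" "a0 \<ge> 0" "b \<ge> 0" for k by (auto simp: a_def a0_def b_def)
    have 1: "cross_rate A B m u p \<le> - a (Suc m) + (\<eta> / 2) * S + C * (a m + b)"
      using C(2) unfolding a_def b_def S_def .
    have "(1 + C) * ((\<Sum>k\<le>m. a k) + X) \<le> (1 + C) * (\<eta> / (2 * (1 + C)) * S + K * (a0 + b))"
      using IH[of p u] C(1) unfolding a_def b_def S_def a0_def X_def by (intro mult_left_mono) auto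
    also have "\<dots> = (\<eta> / 2) * S + (1 + C) * K * (a0 + b)"
      using C(1) by (simp add: field_simps)
    finally have 2: "(\<Sum>k\<le>m. a k) + C * (\<Sum>k\<le>m. a k) + (1 + C) * X \<le> (\<eta> / 2) * S + (1 + C) * K * (a0 + b)"
      by (simp add: algebra_simps)
    have 3: "C * a m \<le> C * (\<Sum>k\<le>m. a k)"
      using C(1) nonneg by (intro mult_left_mono member_le_sum) auto
    have 4: "(\<Sum>k<Suc m. w' k * cross_rate A B k u p) = (1 + C) * X + cross_rate A B m u p"
      by (simp add: w'_def X_def sum_distrib_left mult.assoc)
    have 5: "0 \<le> C * a0" using C(1) nonneg by simp
    have "(\<Sum>k\<le>Suc m. a k) + (\<Sum>k<Suc m. w' k * cross_rate A B k u p)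
        \<le> \<eta> * S + ((1 + C) * K + C) * (a0 + b)"
    proof -
      have eq: "((1 + C) * K + C) * (a0 + b) = (1 + C) * K * (a0 + b) + C * a0 + C * b"
        by (simp add: algebra_simps)
      show ?thesis
        unfolding 4 sum.atMost_Suc eq using 1[unfolded distrib_left[of C]] 2 3 5 by linarith
    qed
    then show "(\<Sum>k\<le>Suc m. (norm (mat_l2 (kalman_row A B k) p))\<^sup>2) + (\<Sum>k<Suc m. w' k * cross_rate A B k u p)
        \<le> \<eta> * (norm p)\<^sup>2 + ((1 + C) * K + C) * ((norm (mat_l2 B p))\<^sup>2 + (norm (mat_l2 B u))\<^sup>2)"
      unfolding a_def S_def a0_def b_def .
  qed
qed

text \<open>Half of the coercivity constant pays for the small error in
  \<open>cross_rate_chain\<close>; the other half remains as dissipation of |p|^2.\<close>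

lemma cross_rate_coercive:
  assumes "c > 0" and coercive: "\<And>p. c * (norm p)\<^sup>2 \<le> (\<Sum>k\<le>m. (norm (mat_l2 (kalman_row A B k) p))\<^sup>2)"
  obtains w K where "K \<ge> 0" "\<And>u p. (\<Sum>k<m. w k * cross_rate A B k u p)
    \<le> - (c / 2) * (norm p)\<^sup>2 + K * ((norm (mat_l2 B p))\<^sup>2 + (norm (mat_l2 B u))\<^sup>2)"
proof -
  obtain w K where K: "K \<ge> 0" and le: "\<And>u p. (\<Sum>k\<le>m. (norm (mat_l2 (kalman_row A B k) p))\<^sup>2)
    + (\<Sum>k<m. w k * cross_rate A B k u p) \<le> (c / 2) * (norm p)\<^sup>2 + K * ((norm (mat_l2 B p))\<^sup>2 + (norm (mat_l2 B u))\<^sup>2)"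
    using cross_rate_chain[where \<eta> = "c / 2" and m = m and A = A and B = B] assms(1) by auto
  show ?thesis
  proof (rule that[OF K])
    fix u p
    show "(\<Sum>k<m. w k * cross_rate A B k u p)
      \<le> - (c / 2) * (norm p)\<^sup>2 + K * ((norm (mat_l2 B p))\<^sup>2 + (norm (mat_l2 B u))\<^sup>2)"
      using le[of p u] coercive[of p] by simp
  qed
qed

text \<open>The corrector J. Term k couples rows k and k + 1, so m terms reach the m + 1 rows of the
  coercive sum.\<close>

definition cross_functional ::
    "real ^ 'n ^ 'n \<Rightarrow> real ^ 'n ^ 'n \<Rightarrow> nat \<Rightarrow> (nat \<Rightarrow> real) \<Rightarrow> (real ^ 'n) l2 \<Rightarrow> (real ^ 'n) l2 \<Rightarrow> real" where
  "cross_functional A B m w u p =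
    (\<Sum>k<m. w k * (mat_l2 (kalman_row A B k) u \<bullet> mat_l2 (kalman_row A B (Suc k)) p))"

lemma cross_functional_bound:
  obtains C where "C \<ge> 0" "\<And>u p. \<bar>cross_functional A B m w u p\<bar> \<le> C * ((norm u)\<^sup>2 + (norm p)\<^sup>2)"
proof -
  have "\<exists>C\<ge>0. \<forall>u. norm (mat_l2 (kalman_row A B k) u) \<le> C * norm u" for k
    by (rule mat_l2_norm_bound[of "kalman_row A B k"]) auto
  then obtain D where D: "\<And>k. D k \<ge> 0" "\<And>k u. norm (mat_l2 (kalman_row A B k) u) \<le> D k * norm u"
    by metis
  show ?thesis
  proof (rule that)
    show "0 \<le> (\<Sum>k<m. \<bar>w k\<bar> * (D k * D (Suc k)))"
      by (intro sum_nonneg mult_nonneg_nonneg D) auto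
    fix u p
    have "\<bar>w k * (mat_l2 (kalman_row A B k) u \<bullet> mat_l2 (kalman_row A B (Suc k)) p)\<bar>
        \<le> (\<bar>w k\<bar> * (D k * D (Suc k))) * ((norm u)\<^sup>2 + (norm p)\<^sup>2)" for k
    proof -
      have "\<bar>mat_l2 (kalman_row A B k) u \<bullet> mat_l2 (kalman_row A B (Suc k)) p\<bar>
          \<le> norm (mat_l2 (kalman_row A B k) u) * norm (mat_l2 (kalman_row A B (Suc k)) p)"
        by (rule Cauchy_Schwarz_ineq2)
      also have "\<dots> \<le> (D k * norm u) * (D (Suc k) * norm p)"
        by (intro mult_mono D mult_nonneg_nonneg norm_ge_zero)
      also have "\<dots> = (D k * D (Suc k)) * (norm u * norm p)" by simp
      also have "\<dots> \<le> (D k * D (Suc k)) * ((norm u)\<^sup>2 + (norm p)\<^sup>2)"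
      proof (rule mult_left_mono)
        have "norm u * norm p \<le> 2 * norm u * norm p" by simp
        then show "norm u * norm p \<le> (norm u)\<^sup>2 + (norm p)\<^sup>2"
          using sum_squares_bound[of "norm u" "norm p"] by linarith
      qed (simp add: D)
      finally show ?thesis
        by (auto simp: abs_mult mult.assoc intro!: mult_left_mono)
    qed
    then show "\<bar>cross_functional A B m w u p\<bar>
        \<le> (\<Sum>k<m. \<bar>w k\<bar> * (D k * D (Suc k))) * ((norm u)\<^sup>2 + (norm p)\<^sup>2)"
      unfolding cross_functional_def sum_distrib_right by (intro sum_abs[THEN order_trans] sum_mono)
  qed
qed

section \<open>Decay of the space derivative and of the damped form along a solution\<close>

context l2_solution
begin

lemma cross_functional_derivative:
  assumes "t \<ge> 0"
  shows "((\<lambda>t. cross_functional A B m w (U t) (P t)) has_real_derivative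
    (\<Sum>k<m. w k * cross_rate A B k (U t) (P t))) (at t within {0..})"
  unfolding cross_functional_def cross_rate_def Let_def evolution[OF assms, symmetric]
  by (intro DERIV_sum DERIV_cmult cross_term_derivative assms)

lemma P_decay:
  assumes \<kappa>: "\<kappa> > 0" "\<And>u. \<kappa> * (norm (mat_l2 B u))\<^sup>2 \<le> u \<bullet> mat_l2 B u"
    and \<delta>: "\<delta> > 0" and K: "K \<ge> 0" "\<And>u p. (\<Sum>k<m. w k * cross_rate A B k u p)
      \<le> - \<delta> * (norm p)\<^sup>2 + K * ((norm (mat_l2 B p))\<^sup>2 + (norm (mat_l2 B u))\<^sup>2)"
    and C: "C \<ge> 0" "\<And>u p. \<bar>cross_functional A B m w u p\<bar> \<le> C * ((norm u)\<^sup>2 + (norm p)\<^sup>2)"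
    and T: "T \<ge> 0"
  shows "(1 + \<delta> * T) * (norm (P T))\<^sup>2 \<le> (K / (2 * \<kappa>) + 2 * C + 1) * ((norm (U 0))\<^sup>2 + (norm (P 0))\<^sup>2)"
proof -
  \<comment> \<open>Three tasks, three summands: K / (2 \<kappa>) lets the dissipation pay for the
    error K in J', C compensates a negative J, and 1 leaves a full |P|^2, so that the functional
    dominates (1 + \<delta> T) |P|^2.\<close>
  define \<Lambda> where "\<Lambda> = K / (2 * \<kappa>) + C + 1"
  define L where "L t = \<Lambda> * (U t \<bullet> U t + P t \<bullet> P t) + cross_functional A B m w (U t) (P t) + \<delta> * t * (P t \<bullet> P t)" for t
  have \<Lambda>: "2 * \<Lambda> * \<kappa> \<ge> K" "\<Lambda> \<ge> 0"
    using \<kappa>(1) C(1) K(1) by (auto simp: \<Lambda>_def algebra_simps)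
  have "L T \<le> L 0"
  proof (rule DERIV_nonpos_imp_decreasing_open[OF T])
    fix t :: real assume t: "0 < t" "t < T"
    define D where "D = \<Lambda> * (- 2 * (U t \<bullet> mat_l2 B (U t)) + - 2 * (P t \<bullet> mat_l2 B (P t)))
        + (\<Sum>k<m. w k * cross_rate A B k (U t) (P t)) + (\<delta> * (P t \<bullet> P t) + \<delta> * t * (- 2 * (P t \<bullet> mat_l2 B (P t))))"
    have "(L has_real_derivative D) (at t)"
      unfolding L_def D_def
      by (rule DERIV_cong, (rule derivative_intros refl derivative_at[OF t(1) energy_derivative]
          energy_P_derivative[OF t(1)] derivative_at[OF t(1) cross_functional_derivative] order_less_imp_le[OF t(1)])+)
         (simp add: algebra_simps)
    moreover have "D \<le> 0"
    proof -
      define b a S where "b = (norm (mat_l2 B (U t)))\<^sup>2" and "a = (norm (mat_l2 B (P t)))\<^sup>2" and "S = (norm (P t))\<^sup>2"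
      have ab: "a \<ge> 0" "b \<ge> 0" by (auto simp: a_def b_def)
      have 1: "\<kappa> * b \<le> U t \<bullet> mat_l2 B (U t)" "\<kappa> * a \<le> P t \<bullet> mat_l2 B (P t)"
        unfolding a_def b_def by (rule \<kappa>)+
      have 2: "(\<Sum>k<m. w k * cross_rate A B k (U t) (P t)) \<le> - \<delta> * S + K * (a + b)"
        unfolding a_def b_def S_def by (rule K)
      have 3: "P t \<bullet> P t = S" by (simp add: S_def power2_norm_eq_inner)
      have 4: "2 * \<Lambda> * (\<kappa> * b + \<kappa> * a) \<le> 2 * \<Lambda> * (U t \<bullet> mat_l2 B (U t) + P t \<bullet> mat_l2 B (P t))"
        using 1 \<Lambda> by (intro mult_left_mono add_mono) auto
      have 5: "K * (a + b) \<le> 2 * \<Lambda> * \<kappa> * (a + b)"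
        using ab \<Lambda> by (intro mult_right_mono) auto
      have "0 \<le> \<kappa> * a" using \<kappa>(1) ab by simp
      then have 6: "0 \<le> \<delta> * t * (P t \<bullet> mat_l2 B (P t))"
        using 1(2) \<delta> t by simp
      show ?thesis
        unfolding D_def 3 using 2 4 5 6 by (simp add: algebra_simps)
    qed
    ultimately show "\<exists>D. (L has_real_derivative D) (at t) \<and> D \<le> 0" by blast
  next
    have "continuous_on {0..} (\<lambda>t. cross_functional A B m w (U t) (P t))"
      unfolding cross_functional_def
      by (intro continuous_intros bounded_linear.continuous_on[OF bounded_linear_mat_l2] U_continuous cont)
    then have "continuous_on {0..} L"
      unfolding L_def by (intro continuous_intros U_continuous cont)
    then show "continuous_on {0..T} L"
      by (rule continuous_on_subset) auto
  qed
  moreover have "L 0 \<le> (\<Lambda> + C) * ((norm (U 0))\<^sup>2 + (norm (P 0))\<^sup>2)"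
    using C(2)[of "U 0" "P 0"] by (simp add: L_def distrib_right power2_norm_eq_inner abs_le_iff)
  moreover have "(1 + \<delta> * T) * (norm (P T))\<^sup>2 \<le> L T"
  proof -
    have "0 \<le> (K / (2 * \<kappa>)) * ((norm (U T))\<^sup>2 + (norm (P T))\<^sup>2)"
      using \<kappa> K by simp
    moreover have "L T = (K / (2 * \<kappa>)) * ((norm (U T))\<^sup>2 + (norm (P T))\<^sup>2) + C * ((norm (U T))\<^sup>2 + (norm (P T))\<^sup>2)
        + (norm (U T))\<^sup>2 + cross_functional A B m w (U T) (P T) + (1 + \<delta> * T) * (norm (P T))\<^sup>2"
      by (simp add: L_def \<Lambda>_def algebra_simps power2_norm_eq_inner)
    moreover have "0 \<le> (norm (U T))\<^sup>2" by simp
    ultimately show ?thesis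
      using C(2)[of "U T" "P T"] by linarith
  qed
  moreover have "\<Lambda> + C = K / (2 * \<kappa>) + 2 * C + 1" by (simp add: \<Lambda>_def)
  ultimately show ?thesis by simp
qed

lemma U_decreasing:
  assumes "\<And>u. 0 \<le> u \<bullet> mat_l2 B u" "T \<ge> 0"
  shows "(norm (U T))\<^sup>2 \<le> (norm (U 0))\<^sup>2"
proof -
  have "U T \<bullet> U T \<le> U 0 \<bullet> U 0"
  proof (rule DERIV_nonpos_imp_decreasing_open[OF assms(2)])
    fix t :: real assume t: "0 < t" "t < T"
    show "\<exists>D. ((\<lambda>t. U t \<bullet> U t) has_real_derivative D) (at t) \<and> D \<le> 0"
      using derivative_at[OF t(1) energy_derivative] t assms(1)[of "U t"] by (intro exI conjI) auto
  qed (intro continuous_intros continuous_on_subset[OF U_continuous], auto)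
  then show ?thesis by (simp add: power2_norm_eq_inner)
qed

text \<open>Young's inequality spends one of the two copies of |B U|^2 on the transport term; the
  other dominates \<kappa> Y, so Y = \<langle>U, B U\<rangle> satisfies Y' \<le> - \<kappa> Y + a
  |P|^2. After multiplication by 1 + t the source is bounded, and the integrating factor
  exp(\<kappa> t) concludes.\<close>

lemma B_form_decay:
  assumes pos: "\<And>u. 0 \<le> u \<bullet> mat_l2 B u"
    and \<kappa>: "\<kappa> > 0" "\<And>u. \<kappa> * (u \<bullet> mat_l2 B u) \<le> (norm (mat_l2 B u))\<^sup>2"
    and C: "C \<ge> 0" "\<And>u. u \<bullet> mat_l2 B u \<le> C * (norm u)\<^sup>2"
    and a: "\<And>u. (norm (mat_l2 A u))\<^sup>2 \<le> a * (norm u)\<^sup>2" "a \<ge> 0"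
    and N: "\<And>t. t \<ge> 0 \<Longrightarrow> (1 + t) * (norm (P t))\<^sup>2 \<le> N"
    and T: "T \<ge> 0"
  shows "(1 + T) * (U T \<bullet> mat_l2 B (U T)) \<le> (C * (norm (U 0))\<^sup>2 + a * N) / \<kappa> + C * (norm (U 0))\<^sup>2"
proof -
  \<comment> \<open>Bounds both sources of ((1 + t) Y)': the derivative of the weight contributes Y,
    at most C |U(0)|^2 because the energy decreases, and the transport term contributes a (1 + t)
    |P|^2.\<close>
  define Q where "Q = C * (norm (U 0))\<^sup>2 + a * N"
  define Y where "Y t = U t \<bullet> mat_l2 B (U t)" for t
  define F where "F t = exp (\<kappa> * t) * ((1 + t) * Y t - Q / \<kappa>)" for t
  have "F T \<le> F 0"
  proof (rule DERIV_nonpos_imp_decreasing_open[OF T])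
    fix t :: real assume t: "0 < t" "t < T"
    define Y' where "Y' = 2 * (mat_l2 B (U t) \<bullet> V t)"
    have Y': "(Y has_real_derivative Y') (at t)"
      unfolding Y_def Y'_def using t by (intro derivative_at B_form_derivative) auto
    have D: "(F has_real_derivative exp (\<kappa> * t) * (\<kappa> * ((1 + t) * Y t) - Q + (Y t + (1 + t) * Y'))) (at t)"
      unfolding F_def using \<kappa>(1)
      by (auto intro!: derivative_eq_intros Y' simp: algebra_simps)
    have "Y' \<le> - \<kappa> * Y t + a * (norm (P t))\<^sup>2"
    proof -
      let ?b = "mat_l2 B (U t)" and ?p = "mat_l2 A (P t)"
      have "Y' = - 2 * (?b \<bullet> ?p) - 2 * (?b \<bullet> ?b)"
        using t by (simp add: Y'_def evolution inner_diff_right)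
      moreover have "- (?b \<bullet> ?p) \<le> norm ?b * norm ?p"
        using Cauchy_Schwarz_ineq2[of ?b ?p] by linarith
      moreover have "2 * norm ?b * norm ?p \<le> (norm ?b)\<^sup>2 + (norm ?p)\<^sup>2"
        by (rule sum_squares_bound)
      moreover have "?b \<bullet> ?b = (norm ?b)\<^sup>2" by (simp add: power2_norm_eq_inner)
      ultimately show ?thesis
        using \<kappa>(2)[of "U t"] a(1)[of "P t"] unfolding Y_def by linarith
    qed
    then have "(1 + t) * Y' \<le> (1 + t) * (- \<kappa> * Y t + a * (norm (P t))\<^sup>2)"
      using t by (intro mult_left_mono) auto
    also have "\<dots> = - (\<kappa> * ((1 + t) * Y t)) + a * ((1 + t) * (norm (P t))\<^sup>2)"
      by (simp add: algebra_simps)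
    also have "\<dots> \<le> - (\<kappa> * ((1 + t) * Y t)) + a * N"
      using N[of t] t a(2) by (intro add_left_mono mult_left_mono) auto
    finally have "(1 + t) * Y' \<le> - (\<kappa> * ((1 + t) * Y t)) + a * N" .
    moreover have "Y t \<le> C * (norm (U 0))\<^sup>2"
      unfolding Y_def using C U_decreasing[OF pos, of t] t
      by (intro order_trans[OF C(2)] mult_left_mono) auto
    ultimately have "\<kappa> * ((1 + t) * Y t) - Q + (Y t + (1 + t) * Y') \<le> 0"
      unfolding Q_def by linarith
    then show "\<exists>D. (F has_real_derivative D) (at t) \<and> D \<le> 0"
      by - (intro exI conjI, rule D, rule mult_nonneg_nonpos, auto)
  next
    show "continuous_on {0..T} F"
      unfolding F_def Y_def
      by (intro continuous_intros bounded_linear.continuous_on[OF bounded_linear_mat_l2]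
          continuous_on_subset[OF U_continuous]) (use \<kappa> in auto)
  qed
  moreover have "F 0 \<le> C * (norm (U 0))\<^sup>2"
  proof -
    have "N \<ge> 0" using order_trans[OF _ N[of 0]] by simp
    then have "0 \<le> Q / \<kappa>" using C a \<kappa>(1) by (simp add: Q_def)
    moreover have "F 0 = U 0 \<bullet> mat_l2 B (U 0) - Q / \<kappa>" by (simp add: F_def Y_def)
    ultimately show ?thesis using C(2)[of "U 0"] by linarith
  qed
  ultimately have "exp (\<kappa> * T) * ((1 + T) * Y T - Q / \<kappa>) \<le> C * (norm (U 0))\<^sup>2"
    unfolding F_def by linarith
  \<comment> \<open>Dropping the factor exp(\<kappa> T) \<ge> 1 is allowed only when the bracket is
    nonnegative; a negative bracket is covered by the 0 in the maximum.\<close>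
  moreover have "(1 + T) * Y T - Q / \<kappa> \<le> max 0 (exp (\<kappa> * T) * ((1 + T) * Y T - Q / \<kappa>))"
  proof (cases "(1 + T) * Y T - Q / \<kappa> \<ge> 0")
    case True
    then have "1 * ((1 + T) * Y T - Q / \<kappa>) \<le> exp (\<kappa> * T) * ((1 + T) * Y T - Q / \<kappa>)"
      using T \<kappa>(1) by (intro mult_right_mono) auto
    then show ?thesis by simp
  qed simp
  moreover have "0 \<le> C * (norm (U 0))\<^sup>2" using C by simp
  ultimately have "(1 + T) * Y T - Q / \<kappa> \<le> C * (norm (U 0))\<^sup>2" by linarith
  then show ?thesis by (simp add: Y_def Q_def)
qed

end

section \<open>The Kalman rank condition and the block structure\<close>

text \<open>The constant is the minimum over the compact unit sphere; homogeneity extends the bound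
  to all vectors.\<close>

lemma quadratic_form_coercive:
  fixes q :: "'a::euclidean_space \<Rightarrow> real"
  assumes "continuous_on UNIV q" and hom: "\<And>r x. q (r *\<^sub>R x) = r\<^sup>2 * q x"
    and pos: "\<And>x. x \<noteq> 0 \<Longrightarrow> q x > 0"
  obtains c where "c > 0" "\<And>x. c * (norm x)\<^sup>2 \<le> q x"
proof -
  have "\<exists>x\<in>sphere 0 1. \<forall>y\<in>sphere 0 1. q x \<le> q y"
    using assms(1) by (intro continuous_attains_inf) (auto intro: continuous_on_subset)
  then obtain x where x: "norm x = 1" "\<And>y. norm y = 1 \<Longrightarrow> q x \<le> q y" by auto
  show ?thesis
  proof (rule that)
    have "x \<noteq> 0" using x(1) by (metis norm_zero zero_neq_one)
    then show "q x > 0" by (rule pos)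
    fix y
    show "q x * (norm y)\<^sup>2 \<le> q y"
    proof (cases "y = 0")
      case True
      then show ?thesis using hom[of 0 0] by simp
    next
      case False
      then have "q x \<le> q ((1 / norm y) *\<^sub>R y)" by (intro x) simp
      then show ?thesis
        using False unfolding hom by (simp add: field_simps)
    qed
  qed
qed

lemma transpose_kalman_block:
  assumes "transpose A = A" "transpose B = B"
  shows "transpose ((((**) A) ^^ k) B) = kalman_row A B k"
  by (induction k) (simp_all add: matrix_transpose_mul assms)

text \<open>If B A^k x vanishes, then x is orthogonal to every column of its transpose A^k B. These
  columns span the whole space by the rank condition, so x is orthogonal to itself.\<close>

lemma kalman_rows_injective:
  fixes A B :: "real ^ 'n ^ 'n"
  assumes sym: "transpose A = A" "transpose B = B" and "kalman_rank_condition A B"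
    and zero: "\<And>k. k < CARD('n) \<Longrightarrow> kalman_row A B k *v x = 0"
  shows "x = 0"
proof -
  have "span (columns (kalman_matrix A B)) = UNIV"
    using assms(3) dim_eq_full[of "columns (kalman_matrix A B)"]
    by (simp add: kalman_rank_condition_def column_rank_def)
  then have "x \<in> span (columns (kalman_matrix A B))" by simp
  then have "orthogonal x x"
  proof (rule orthogonal_to_span)
    fix y assume "y \<in> columns (kalman_matrix A B)"
    then obtain k j where k: "k < CARD('n)" and y: "y = column j ((((**) A) ^^ k) B)"
      unfolding columns_kalman_matrix by (auto simp: columns_def)
    have "y \<bullet> x = (transpose ((((**) A) ^^ k) B) *v x) $ j"
      by (simp add: y column_def inner_vec_def matrix_vector_mult_def transpose_def)
    then show "orthogonal x y"
      using zero[OF k] by (simp add: transpose_kalman_block sym orthogonal_def inner_commute)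
  qed
  then show ?thesis by (simp add: orthogonal_def)
qed

lemma kalman_coercive_l2:
  fixes A B :: "real ^ 'n ^ 'n"
  assumes "transpose A = A" "transpose B = B" "kalman_rank_condition A B"
  obtains c where "c > 0"
    "\<And>p. c * (norm p)\<^sup>2 \<le> (\<Sum>k\<le>CARD('n). (norm (mat_l2 (kalman_row A B k) p))\<^sup>2)"
proof -
  let ?M = "kalman_row A B"
  obtain c where c: "c > 0" "\<And>x. c * (norm x)\<^sup>2 \<le> (\<Sum>k\<le>CARD('n). (norm (?M k *v x))\<^sup>2)"
  proof (rule quadratic_form_coercive)
    show "continuous_on UNIV (\<lambda>x. \<Sum>k\<le>CARD('n). (norm (?M k *v x))\<^sup>2)"
      by (intro continuous_intros bounded_linear.continuous_on[OF matrix_vector_mul_bounded_linear])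
    show "(\<Sum>k\<le>CARD('n). (norm (?M k *v (r *\<^sub>R x)))\<^sup>2) = r\<^sup>2 * (\<Sum>k\<le>CARD('n). (norm (?M k *v x))\<^sup>2)" for r x
      by (simp add: matrix_vector_mult_scaleR power_mult_distrib sum_distrib_left)
    show "0 < (\<Sum>k\<le>CARD('n). (norm (?M k *v x))\<^sup>2)" if "x \<noteq> 0" for x
    proof (rule ccontr)
      assume "\<not> 0 < (\<Sum>k\<le>CARD('n). (norm (?M k *v x))\<^sup>2)"
      then have "(\<Sum>k\<le>CARD('n). (norm (?M k *v x))\<^sup>2) = 0"
        by (intro antisym sum_nonneg) auto
      then have "?M k *v x = 0" if "k < CARD('n)" for k
        using that by (subst (asm) sum_nonneg_eq_0_iff) auto
      from kalman_rows_injective[OF assms this] show False using \<open>x \<noteq> 0\<close> by blast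
    qed
  qed blast
  show ?thesis
  proof (rule that[OF c(1)])
    fix p
    \<comment> \<open>The squared norm of p is written as the form of the identity matrix over a
      one-point index set, to match \<open>quadratic_form_mono_l2\<close>.\<close>
    have "c * (\<Sum>i\<in>{()}. mat_l2 (mat 1) p \<bullet> mat_l2 (mat 1) p)
        \<le> (\<Sum>k\<le>CARD('n). mat_l2 (?M k) p \<bullet> mat_l2 (?M k) p)"
      by (rule quadratic_form_mono_l2) (use c(2) in \<open>auto simp: power2_norm_eq_inner\<close>)
    then show "c * (norm p)\<^sup>2 \<le> (\<Sum>k\<le>CARD('n). (norm (mat_l2 (?M k) p))\<^sup>2)"
      by (simp add: power2_norm_eq_inner)
  qed
qed

section \<open>The block structure of the damping matrix\<close>

lemma sum_UNIV_Plus: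
  fixes f :: "'p::finite + 'q::finite \<Rightarrow> real"
  shows "sum f UNIV = (\<Sum>i\<in>UNIV. f (Inl i)) + (\<Sum>j\<in>UNIV. f (Inr j))"
  unfolding UNIV_Plus_UNIV[symmetric] by (subst sum.Plus) simp_all

lemma snd_block_block_diag: "snd_block (block_diag_zero D *v x) = D *v snd_block x"
  by (simp add: snd_block_def block_diag_zero_def matrix_vector_mult_def sum_UNIV_Plus)

lemma inner_block_diag: "x \<bullet> (block_diag_zero D *v y) = snd_block x \<bullet> (D *v snd_block y)"
  by (simp add: snd_block_def block_diag_zero_def matrix_vector_mult_def sum_UNIV_Plus inner_vec_def)

text \<open>Projection onto the second block as a matrix, so that U_2 becomes an instance of
  \<open>mat_l2\<close>.\<close>

definition snd_matrix :: "real ^ ('p::finite + 'q::finite) ^ 'q" where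
  "snd_matrix = (\<chi> j i. if i = Inr j then 1 else 0)"

lemma snd_matrix_mult: "snd_matrix *v x = snd_block x"
  by (simp add: snd_matrix_def snd_block_def matrix_vector_mult_def sum_UNIV_Plus
      if_distrib[where f = "\<lambda>c. c * z" for z] cong: if_cong)

lemma pos_def_matrix_bounds:
  fixes D :: "real ^ 'q ^ 'q"
  assumes "pos_def_matrix D"
  obtains d \<kappa> where "d > 0" "\<kappa> > 0" "\<And>y. d * (norm y)\<^sup>2 \<le> y \<bullet> (D *v y)"
    "\<And>y. d * (y \<bullet> (D *v y)) \<le> (norm (D *v y))\<^sup>2" "\<And>y. \<kappa> * (norm (D *v y))\<^sup>2 \<le> y \<bullet> (D *v y)"
proof -
  obtain d where d: "d > 0" "\<And>y. d * (norm y)\<^sup>2 \<le> y \<bullet> (D *v y)"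
  proof (rule quadratic_form_coercive)
    show "continuous_on UNIV (\<lambda>y. y \<bullet> (D *v y))"
      by (intro continuous_intros bounded_linear.continuous_on[OF matrix_vector_mul_bounded_linear])
    show "(r *\<^sub>R y) \<bullet> (D *v (r *\<^sub>R y)) = r\<^sup>2 * (y \<bullet> (D *v y))" for r y
      by (simp add: matrix_vector_mult_scaleR power2_eq_square)
  qed (use assms in \<open>auto simp: pos_def_matrix_def\<close>)
  obtain K where K: "K > 0" "\<And>y. norm (D *v y) \<le> norm y * K"
    using bounded_linear.pos_bounded[OF matrix_vector_mul_bounded_linear[of D]] by auto
  show ?thesis
  \<comment> \<open>The second constant is d / K^2 because |D y|^2 \<le> K^2 |y|^2 \<le> (K^2 / d)
    \<langle>y, D y\<rangle>.\<close>
  proof (rule that[OF d(1) _ d(2), of "d / K\<^sup>2"])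
    show "d / K\<^sup>2 > 0" using d K by simp
    fix y
    have le: "y \<bullet> (D *v y) \<le> norm y * norm (D *v y)" by (rule norm_cauchy_schwarz)
    \<comment> \<open>Coercivity and Cauchy-Schwarz give d |y|^2 \<le> |y| |D y|; then |y| is
      cancelled.\<close>
    have "d * norm y \<le> norm (D *v y)"
    proof (cases "y = 0")
      case False
      have "norm y * (d * norm y) \<le> norm y * norm (D *v y)"
        using order_trans[OF d(2) le] by (simp add: power2_eq_square algebra_simps)
      then show ?thesis using False by simp
    qed simp
    then have "d * norm y * norm (D *v y) \<le> norm (D *v y) * norm (D *v y)"
      by (rule mult_right_mono) simp
    moreover have "d * (y \<bullet> (D *v y)) \<le> d * (norm y * norm (D *v y))"
      using le d(1) by (intro mult_left_mono) auto
    ultimately show "d * (y \<bullet> (D *v y)) \<le> (norm (D *v y))\<^sup>2"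
      by (simp add: power2_eq_square mult.assoc)
    have "(norm (D *v y))\<^sup>2 \<le> (norm y * K)\<^sup>2"
      using K by (intro power_mono) auto
    then have "(d / K\<^sup>2) * (norm (D *v y))\<^sup>2 \<le> (d / K\<^sup>2) * (norm y * K)\<^sup>2"
      using d(1) by (intro mult_left_mono) auto
    also have "\<dots> = d * (norm y)\<^sup>2"
      using K(1) by (simp add: power_mult_distrib)
    finally show "(d / K\<^sup>2) * (norm (D *v y))\<^sup>2 \<le> y \<bullet> (D *v y)"
      using d(2)[of y] by linarith
  qed
qed

text \<open>The bounds serve, in order, to recover U_2 from the damped form, to damp that form
  exponentially, and to control |B u|^2 by the dissipation.\<close>

lemma block_diag_bounds_l2:
  fixes B :: "real ^ ('p::finite + 'q::finite) ^ ('p + 'q)" and D :: "real ^ 'q ^ 'q"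
  assumes "pos_def_matrix D" and B: "B = block_diag_zero D"
  obtains d \<kappa> where "d > 0" "\<kappa> > 0"
    "\<And>u. d * (norm (mat_l2 (snd_matrix :: real ^ ('p + 'q) ^ 'q) u))\<^sup>2 \<le> u \<bullet> mat_l2 B u"
    "\<And>u. d * (u \<bullet> mat_l2 B u) \<le> (norm (mat_l2 B u))\<^sup>2" "\<And>u. \<kappa> * (norm (mat_l2 B u))\<^sup>2 \<le> u \<bullet> mat_l2 B u"
proof -
  obtain d \<kappa> where d: "d > 0" "\<kappa> > 0" "\<And>y. d * (norm y)\<^sup>2 \<le> y \<bullet> (D *v y)"
    "\<And>y. d * (y \<bullet> (D *v y)) \<le> (norm (D *v y))\<^sup>2" "\<And>y. \<kappa> * (norm (D *v y))\<^sup>2 \<le> y \<bullet> (D *v y)"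
    by (rule pos_def_matrix_bounds[OF assms(1)]) blast
  show ?thesis
  proof (rule that[OF d(1,2)])
    fix u :: "(real ^ ('p + 'q)) l2"
    have "d * (\<Sum>i\<in>{()}. mat_l2 (snd_matrix :: real ^ ('p + 'q) ^ 'q) u \<bullet> mat_l2 (snd_matrix :: real ^ ('p + 'q) ^ 'q) u)
        \<le> (\<Sum>i\<in>{()}. mat_l2 (mat 1) u \<bullet> mat_l2 B u)"
      by (rule quadratic_form_mono_l2)
         (use d(3) in \<open>auto simp: snd_matrix_mult B inner_block_diag power2_norm_eq_inner\<close>)
    then show "d * (norm (mat_l2 (snd_matrix :: real ^ ('p + 'q) ^ 'q) u))\<^sup>2 \<le> u \<bullet> mat_l2 B u"
      by (simp add: power2_norm_eq_inner)
    have "d * (\<Sum>i\<in>{()}. mat_l2 (mat 1) u \<bullet> mat_l2 B u) \<le> (\<Sum>i\<in>{()}. mat_l2 B u \<bullet> mat_l2 B u)"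
      by (rule quadratic_form_mono_l2)
         (use d(4) in \<open>auto simp: B inner_block_diag snd_block_block_diag power2_norm_eq_inner\<close>)
    then show "d * (u \<bullet> mat_l2 B u) \<le> (norm (mat_l2 B u))\<^sup>2"
      by (simp add: power2_norm_eq_inner)
    have "\<kappa> * (\<Sum>i\<in>{()}. mat_l2 B u \<bullet> mat_l2 B u) \<le> (\<Sum>i\<in>{()}. mat_l2 (mat 1) u \<bullet> mat_l2 B u)"
      by (rule quadratic_form_mono_l2)
         (use d(5) in \<open>auto simp: B inner_block_diag snd_block_block_diag power2_norm_eq_inner\<close>)
    then show "\<kappa> * (norm (mat_l2 B u))\<^sup>2 \<le> u \<bullet> mat_l2 B u"
      by (simp add: power2_norm_eq_inner)
  qed
qed

section \<open>The decay estimate\<close>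

lemma abs_l2_minus: "f \<in> L2 \<Longrightarrow> - abs_l2 f = abs_l2 (\<lambda>x. - f x)"
  by (simp add: uminus_l2.abs_eq l2rel_def)

lemma solves_system_l2_solution:
  fixes A B :: "real ^ 'n ^ 'n"
  assumes sym: "transpose A = A" "transpose B = B" and sol: "solves_system A B U0 U"
  obtains V where "l2_solution A B (\<lambda>t. abs_l2 (U t)) (\<lambda>t. abs_l2 (weak_deriv (U t))) V"
proof -
  have H1: "\<And>t. t \<ge> 0 \<Longrightarrow> U t \<in> H1"
    and contH: "\<And>t. t \<ge> 0 \<Longrightarrow> ((\<lambda>s. H1_norm (\<lambda>x. U s x - U t x)) \<longlongrightarrow> 0) (at t within {0..})"
    using sol unfolding solves_system_def by auto
  obtain V where V: "\<And>t. t \<ge> 0 \<Longrightarrow> V t \<in> L2"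
    and dV: "\<And>t. t \<ge> 0 \<Longrightarrow>
        ((\<lambda>s. L2_norm (\<lambda>x. (1 / (s - t)) *\<^sub>R (U s x - U t x) - V t x)) \<longlongrightarrow> 0) (at t within {0..})"
    and eq: "\<And>t. t \<ge> 0 \<Longrightarrow> AE x in lborel. V t x + A *v weak_deriv (U t) x = - (B *v U t x)"
    using sol unfolding solves_system_def by auto
  note L2 = H1_L2[OF H1] weak_deriv_H1(1)[OF H1]
  have "l2_solution A B (\<lambda>t. abs_l2 (U t)) (\<lambda>t. abs_l2 (weak_deriv (U t))) (\<lambda>t. abs_l2 (V t))"
  proof
    fix t :: real assume t: "t \<ge> 0"
    show "l2_deriv (abs_l2 (U t)) (abs_l2 (weak_deriv (U t)))"
      by (rule H1_l2_deriv[OF H1[OF t]])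
    \<comment> \<open>Membership in \<open>H1\<close> is known for s \<ge> 0 only, so the two norms
      are compared along the filter within the half-line.\<close>
    have "\<forall>\<^sub>F s in at t within {0..}. L2_norm (\<lambda>x. (1 / (s - t)) *\<^sub>R (U s x - U t x) - V t x)
        = norm ((1 / (s - t)) *\<^sub>R (abs_l2 (U s) - abs_l2 (U t)) - abs_l2 (V t))"
      unfolding eventually_at_filter
      by (rule always_eventually)
         (use t in \<open>auto simp: abs_l2_diff abs_l2_scaleR norm_abs_l2 L2 V L2_diff L2_scaleR\<close>)
    from Lim_transform_eventually[OF dV[OF t] this]
    show "((\<lambda>s. (1 / (s - t)) *\<^sub>R (abs_l2 (U s) - abs_l2 (U t))) \<longlongrightarrow> abs_l2 (V t)) (at t within {0..})"
      by (rule LIM_zero_cancel[OF tendsto_norm_zero_cancel])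
    have "abs_l2 (\<lambda>x. V t x + A *v weak_deriv (U t) x) = abs_l2 (\<lambda>x. - (B *v U t x))"
      using t eq[OF t] by (subst abs_l2_eq_iff) (auto intro!: L2_add L2_minus L2_mat L2 V)
    then have "abs_l2 (V t) + mat_l2 A (abs_l2 (weak_deriv (U t))) = - mat_l2 B (abs_l2 (U t))"
      using t by (simp add: abs_l2_add abs_l2_minus mat_l2_abs L2 V L2_mat)
    then show "abs_l2 (V t) = - mat_l2 A (abs_l2 (weak_deriv (U t))) - mat_l2 B (abs_l2 (U t))"
      by (simp add: algebra_simps eq_neg_iff_add_eq_0)
  next
    show "continuous_on {0..} (\<lambda>t. abs_l2 (weak_deriv (U t)))"
      unfolding continuous_on_def
    proof
      fix t :: real assume t: "t \<in> {0..}"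
      show "((\<lambda>s. abs_l2 (weak_deriv (U s))) \<longlongrightarrow> abs_l2 (weak_deriv (U t))) (at t within {0..})"
      proof (rule LIM_zero_cancel, rule Lim_null_comparison)
        show "\<forall>\<^sub>F s in at t within {0..}. norm (abs_l2 (weak_deriv (U s)) - abs_l2 (weak_deriv (U t)))
            \<le> H1_norm (\<lambda>x. U s x - U t x)"
          unfolding eventually_at_filter
          by (rule always_eventually) (use t in \<open>auto simp: H1_norm_diff H1\<close>)
        show "((\<lambda>s. H1_norm (\<lambda>x. U s x - U t x)) \<longlongrightarrow> 0) (at t within {0..})"
          using t by (intro contH) simp
      qed
    qed
  qed (rule sym)+
  then show ?thesis by (rule that)
qed

text \<open>The initial values agree almost everywhere, hence as classes; their chosen weak
  derivatives then agree as classes because the generator is single-valued.\<close>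

lemma solves_system_initial:
  assumes "solves_system A B U0 U" "U0 \<in> H1"
  shows "(norm (abs_l2 (U 0)))\<^sup>2 + (norm (abs_l2 (weak_deriv (U 0))))\<^sup>2 = (H1_norm U0)\<^sup>2"
proof -
  have H: "U 0 \<in> H1" and "AE x in lborel. U 0 x = U0 x"
    using assms(1) by (auto simp: solves_system_def)
  then have 1: "abs_l2 (U 0) = abs_l2 U0"
    using assms(2) by (simp add: abs_l2_eq_iff H1_L2)
  have "abs_l2 (weak_deriv (U 0)) = abs_l2 (weak_deriv U0)"
    using H1_l2_deriv[OF H] H1_l2_deriv[OF assms(2)] unfolding 1 by (rule l2_deriv_unique)
  then show ?thesis
    using 1 assms(2) by (simp add: H1_norm_def norm_abs_l2 H1_L2 weak_deriv_H1(1))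
qed

lemma sqrt_decay:
  fixes x h c t :: real
  assumes "(1 + t) * x\<^sup>2 \<le> c * h\<^sup>2" "t \<ge> 0" "h \<ge> 0"
  shows "x \<le> sqrt c * (1 + t) powr (- 1 / 2) * h"
proof -
  have "x\<^sup>2 \<le> c * h\<^sup>2 / (1 + t)"
    using assms by (simp add: field_simps)
  then have "x \<le> sqrt (c * h\<^sup>2 / (1 + t))" by (rule real_le_rsqrt)
  also have "\<dots> = sqrt c * (1 + t) powr (- (1 / 2)) * h"
    using assms by (simp add: real_sqrt_mult real_sqrt_divide powr_minus_divide powr_half_sqrt)
  finally show ?thesis by simp
qed

lemma mat_l2_square_bound:
  obtains a where "a \<ge> 0" "\<And>u. (norm (mat_l2 M u))\<^sup>2 \<le> a * (norm u)\<^sup>2"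
proof -
  obtain K where K: "K \<ge> 0" "\<And>u. norm (mat_l2 M u) \<le> K * norm u"
    using mat_l2_norm_bound by blast
  show ?thesis
  proof (rule that)
    show "K\<^sup>2 \<ge> 0" by simp
    show "(norm (mat_l2 M u))\<^sup>2 \<le> K\<^sup>2 * (norm u)\<^sup>2" for u
      using power_mono[OF K(2)[of u] norm_ge_zero, of 2] by (simp add: power_mult_distrib)
  qed
qed

text \<open>All constants are fixed from the matrices before any solution is introduced, which makes
  the estimate uniform in time and in the initial datum.\<close>

lemma l2_solution_decay:
  fixes A B :: "real ^ ('p::finite + 'q::finite) ^ ('p + 'q)" and D :: "real ^ 'q ^ 'q"
  assumes sym: "transpose A = A" "transpose B = B" and B: "B = block_diag_zero D"
    and D: "pos_def_matrix D" and kalman: "kalman_rank_condition A B"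
  obtains C1 C2 where "C1 \<ge> 0" "C2 \<ge> 0"
    "\<And>U P V t. l2_solution A B U P V \<Longrightarrow> t \<ge> 0 \<Longrightarrow>
      (1 + t) * (norm (P t))\<^sup>2 \<le> C1 * ((norm (U 0))\<^sup>2 + (norm (P 0))\<^sup>2) \<and>
      (1 + t) * (norm (mat_l2 (snd_matrix :: real ^ ('p + 'q) ^ 'q) (U t)))\<^sup>2 \<le> C2 * ((norm (U 0))\<^sup>2 + (norm (P 0))\<^sup>2)"
proof -
  obtain c where c: "c > 0"
    "\<And>p. c * (norm p)\<^sup>2 \<le> (\<Sum>k\<le>CARD('p + 'q). (norm (mat_l2 (kalman_row A B k) p))\<^sup>2)"
    by (rule kalman_coercive_l2[OF sym kalman]) blast
  let ?m = "CARD('p + 'q)"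
  obtain w K where K: "K \<ge> 0" "\<And>u p. (\<Sum>k<?m. w k * cross_rate A B k u p)
    \<le> - (c / 2) * (norm p)\<^sup>2 + K * ((norm (mat_l2 B p))\<^sup>2 + (norm (mat_l2 B u))\<^sup>2)"
    by (rule cross_rate_coercive[OF c]) blast
  obtain C where C: "C \<ge> 0"
    "\<And>u p. \<bar>cross_functional A B ?m w u p\<bar> \<le> C * ((norm u)\<^sup>2 + (norm p)\<^sup>2)"
    by (rule cross_functional_bound) blast
  obtain d \<kappa> where d: "d > 0" "\<kappa> > 0"
    "\<And>u. d * (norm (mat_l2 (snd_matrix :: real ^ ('p + 'q) ^ 'q) u))\<^sup>2 \<le> u \<bullet> mat_l2 B u"
    "\<And>u. d * (u \<bullet> mat_l2 B u) \<le> (norm (mat_l2 B u))\<^sup>2" "\<And>u. \<kappa> * (norm (mat_l2 B u))\<^sup>2 \<le> u \<bullet> mat_l2 B u"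
    by (rule block_diag_bounds_l2[OF D B]) blast
  obtain a where a: "a \<ge> 0" "\<And>u. (norm (mat_l2 A u))\<^sup>2 \<le> a * (norm u)\<^sup>2"
    using mat_l2_square_bound by blast
  obtain b where b: "b \<ge> 0" "\<And>u. norm (mat_l2 B u) \<le> b * norm u"
    using mat_l2_norm_bound by blast
  have pos: "0 \<le> u \<bullet> mat_l2 B u" for u
    by (rule order_trans[OF _ d(5)[of u]]) (use d in simp)
  have B_le: "u \<bullet> mat_l2 B u \<le> b * (norm u)\<^sup>2" for u
  proof -
    have "u \<bullet> mat_l2 B u \<le> norm u * norm (mat_l2 B u)" by (rule norm_cauchy_schwarz)
    also have "\<dots> \<le> norm u * (b * norm u)" by (intro mult_left_mono b) auto
    finally show ?thesis by (simp add: power2_eq_square mult_ac)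
  qed
  \<comment> \<open>Converts the weight 1 + (c/2) t of \<open>P_decay\<close> into a multiple of 1 +
    t.\<close>
  define \<mu> where "\<mu> = min 1 (c / 2)"
  have \<mu>: "\<mu> > 0" "\<mu> \<le> 1" "\<mu> \<le> c / 2" using c by (auto simp: \<mu>_def)
  define C0 where "C0 = K / (2 * \<kappa>) + 2 * C + 1"
  define C1 where "C1 = C0 / \<mu>"
  \<comment> \<open>The inner expression is the constant from \<open>B_form_decay\<close> with N =
    C1 E; the last division by d passes from \<langle>U, B U\<rangle> to |U_2|^2.\<close>
  define C2 where "C2 = ((b + a * C1) / d + b) / d"
  have C0: "C0 \<ge> 0" using K C d by (simp add: C0_def)
  have C1: "C1 \<ge> 0" using C0 \<mu> by (simp add: C1_def)
  have C2: "C2 \<ge> 0" using C1 a b d by (simp add: C2_def)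
  show ?thesis
  proof (rule that[OF C1 C2], intro conjI)
    fix U P V and t :: real assume "l2_solution A B U P V" and t: "t \<ge> 0"
    then interpret l2_solution A B U P V by simp
    define E where "E = (norm (U 0))\<^sup>2 + (norm (P 0))\<^sup>2"
    have E: "(norm (U 0))\<^sup>2 \<le> E" "0 \<le> E" by (auto simp: E_def)
    have P: "(1 + s) * (norm (P s))\<^sup>2 \<le> C1 * E" if s: "s \<ge> 0" for s
    proof -
      have "\<mu> * s \<le> (c / 2) * s" using \<mu> s by (intro mult_right_mono) auto
      then have "\<mu> * (1 + s) \<le> 1 + c / 2 * s" using \<mu> by (simp add: distrib_left)
      then have "\<mu> * (1 + s) * (norm (P s))\<^sup>2 \<le> (1 + c / 2 * s) * (norm (P s))\<^sup>2"
        by (rule mult_right_mono) simp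
      also have "\<dots> \<le> C0 * E"
        unfolding C0_def E_def by (rule P_decay[OF d(2) d(5) _ K C s]) (use c in simp)
      finally show ?thesis using \<mu>(1) by (simp add: C1_def field_simps)
    qed
    then show "(1 + t) * (norm (P t))\<^sup>2 \<le> C1 * ((norm (U 0))\<^sup>2 + (norm (P 0))\<^sup>2)"
      using t by (simp add: E_def)
    have "(1 + t) * (U t \<bullet> mat_l2 B (U t)) \<le> (b * (norm (U 0))\<^sup>2 + a * (C1 * E)) / d + b * (norm (U 0))\<^sup>2"
      by (rule B_form_decay[OF pos d(1,4) b(1) B_le a(2,1) P t])
    also have "\<dots> \<le> (b * E + a * (C1 * E)) / d + b * E"
      using b(1) d(1) E by (intro add_mono divide_right_mono mult_left_mono) (auto simp: C1 a(1))
    also have "\<dots> = d * C2 * E"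
      using d(1) by (simp add: C2_def field_simps)
    finally have "(1 + t) * (U t \<bullet> mat_l2 B (U t)) \<le> d * C2 * E" .
    moreover have "(1 + t) * (d * (norm (mat_l2 (snd_matrix :: real ^ ('p + 'q) ^ 'q) (U t)))\<^sup>2)
        \<le> (1 + t) * (U t \<bullet> mat_l2 B (U t))"
      using t d(3)[of "U t"] by (intro mult_left_mono) auto
    ultimately have "d * ((1 + t) * (norm (mat_l2 (snd_matrix :: real ^ ('p + 'q) ^ 'q) (U t)))\<^sup>2) \<le> d * (C2 * E)"
      by (simp add: mult_ac)
    then show "(1 + t) * (norm (mat_l2 (snd_matrix :: real ^ ('p + 'q) ^ 'q) (U t)))\<^sup>2
        \<le> C2 * ((norm (U 0))\<^sup>2 + (norm (P 0))\<^sup>2)"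
      using d(1) by (simp add: E_def)
  qed
qed

theorem theorem2p1:
  fixes A B :: "real ^ ('p::finite + 'q::finite) ^ ('p + 'q)"
    and D :: "real ^ 'q ^ 'q"
  assumes "transpose A = A"
    and "transpose B = B"
    and "B = block_diag_zero D"
    and "pos_def_matrix D"
    and "kalman_rank_condition A B"
  shows "\<exists>C>0. \<forall>U0 U. U0 \<in> H1 \<longrightarrow> solves_system A B U0 U \<longrightarrow>
    (\<forall>t>0. L2_norm (\<lambda>x. snd_block (U t x)) + L2_norm (weak_deriv (U t))
             \<le> C * (1 + t) powr (- 1 / 2) * H1_norm U0)"
proof -
  obtain C1 C2 where C: "C1 \<ge> 0" "C2 \<ge> 0" and decay:
    "\<And>U P V t. l2_solution A B U P V \<Longrightarrow> t \<ge> 0 \<Longrightarrow>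
      (1 + t) * (norm (P t))\<^sup>2 \<le> C1 * ((norm (U 0))\<^sup>2 + (norm (P 0))\<^sup>2) \<and>
      (1 + t) * (norm (mat_l2 (snd_matrix :: real ^ ('p + 'q) ^ 'q) (U t)))\<^sup>2 \<le> C2 * ((norm (U 0))\<^sup>2 + (norm (P 0))\<^sup>2)"
    using l2_solution_decay[OF assms] by blast
  show ?thesis
  \<comment> \<open>The summand 1 makes the constant strictly positive even if both square roots
    vanish.\<close>
  proof (intro exI[of _ "sqrt C2 + sqrt C1 + 1"] conjI allI impI)
    show "0 < sqrt C2 + sqrt C1 + 1" using C by (simp add: add_nonneg_pos)
    fix U0 U and t :: real
    assume U0: "U0 \<in> H1" and sol: "solves_system A B U0 U" and t: "t > 0"
    obtain V where "l2_solution A B (\<lambda>t. abs_l2 (U t)) (\<lambda>t. abs_l2 (weak_deriv (U t))) V"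
      using solves_system_l2_solution[OF assms(1,2) sol] by blast
    note * = decay[OF this less_imp_le[OF t], unfolded solves_system_initial[OF sol U0]]
    have H1: "U t \<in> H1" using sol t by (simp add: solves_system_def)
    have "mat_l2 snd_matrix (abs_l2 (U t)) = abs_l2 (\<lambda>x. snd_block (U t x))"
      by (simp add: mat_l2_abs H1_L2[OF H1] snd_matrix_mult)
    moreover have "(\<lambda>x. snd_block (U t x)) \<in> L2"
      using L2_mat[OF H1_L2[OF H1], of snd_matrix] by (simp add: snd_matrix_mult)
    ultimately have eq: "norm (mat_l2 (snd_matrix :: real ^ ('p + 'q) ^ 'q) (abs_l2 (U t))) = L2_norm (\<lambda>x. snd_block (U t x))"
      "norm (abs_l2 (weak_deriv (U t))) = L2_norm (weak_deriv (U t))"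
      by (simp_all add: norm_abs_l2 weak_deriv_H1(1)[OF H1])
    have H: "H1_norm U0 \<ge> 0" by (simp add: H1_norm_def)
    have "L2_norm (\<lambda>x. snd_block (U t x)) \<le> sqrt C2 * (1 + t) powr (- 1 / 2) * H1_norm U0"
      "L2_norm (weak_deriv (U t)) \<le> sqrt C1 * (1 + t) powr (- 1 / 2) * H1_norm U0"
      using * t H unfolding eq by (intro sqrt_decay; simp)+
    moreover have "0 \<le> (1 + t) powr (- 1 / 2) * H1_norm U0"
      using H by simp
    ultimately show "L2_norm (\<lambda>x. snd_block (U t x)) + L2_norm (weak_deriv (U t))
        \<le> (sqrt C2 + sqrt C1 + 1) * (1 + t) powr (- 1 / 2) * H1_norm U0"
      by (simp only: distrib_right mult_1_left)
  qed
qed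

end
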